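(* Let $\gamma>0$ and assume that $\mathcal{D}$ is nonempty. Then a minimizer of the cost $J$ exists in $\mathcal{D}$; that is, there exists $(V_{\mathrm{op}},W_{\mathrm{op}})\in\mathcal{D}$ such that $$J(V_{\mathrm{op}},W_{\mathrm{op}})\le J(V,W)\qquad\text{for all }(V,W)\in\mathcal{D}.$$ Let $\mathcal{P}_0=\{(V,W)\in\mathcal{P} : V=W\}$ and assume in addition that $\mathcal{D}\cap\mathcal{P}_0$ is nonempty. Then, as $\gamma\to\infty$, any choice of minimizers $(V_{\mathrm{op}}(\gamma),W_{\mathrm{op}}(\gamma))$ of $J(\cdot,\cdot\,;\gamma)$ over $\mathcal{D}$ approaches $\mathcal{D}\cap\mathcal{P}_0$. Furthermore, writing $J(V,W;\gamma)$ for the cost with weight $\gamma$, the corresponding cost $J(V_{\mathrm{op}}(\gamma),W_{\mathrm{op}}(\gamma);\gamma)$ approaches, as $\gamma\to\infty$, the minimum of $J$ over $\mathcal{D}\cap\mathcal{P}_0$, i.e. $$\lim_{\gamma\to\infty}J(V_{\mathrm{op}}(\gamma),W_{\mathrm{op}}(\gamma);\gamma)\le J(V,V)\qquad\text{for all }V\in\mathcal{G}_{n,r}\text{ with }(V,V)\in\mathcal{D}$$ (here $J(V,V)$ does not depend on $\gamma$, since $\rho(V,V)=0$).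
   Context: Setting. Fix integers $1\le r\le n$ and $d,m,L\ge 1$, an initial condition $x_0\in\mathbb{R}^n$, an input signal $u(t)\in\mathbb{R}^d$, and sample times $t_0<\cdots<t_{L-1}$. The full-order model is $\frac{d}{dt}x=f(x,u)$, $x(t_0)=x_0$, $y=g(x)$, with $x\in\mathbb{R}^n$, $y\in\mathbb{R}^m$; its observations are $y_l=y(t_l)$. Standing assumption: $(x,t)\mapsto f(x,u(t))$ and $x\mapsto g(x)$ have continuous partial derivatives with respect to $x$ up to second order (including order zero). $\mathcal{G}_{n,r}$ is the Grassmann manifold of $r$-dimensional subspaces of $\mathbb{R}^n$ and $\mathcal{P}=\{(V,W)\in\mathcal{G}_{n,r}\times\mathcal{G}_{n,r}: V\oplus W^\perp=\mathbb{R}^n\}$. For $(V,W)\in\mathcal{P}$, $P_{V,W}$ is the projection with range $V$ and kernel $W^\perp$; if $V=\operatorname{Range}\Phi$, $W=\operatorname{Range}\Psi$ with $\Phi,\Psi\in\mathbb{R}^{n\times r}$, then $P_{V,W}=\Phi(\Psi^T\Phi)^{-1}\Psi^T$. The reduced-order model (ROM) is $$\tfrac{d}{dt}\hat x=P_{V,W}f(\hat x,u),\qquad \hat x(t_0)=P_{V,W}x_0,\qquad \hat y=g(\hat x).$$ $\mathcal{D}\subset\mathcal{P}$ is the set of $(V,W)$ for which the ROM has a unique solution $\hat x(t;(V,W))$ over $[t_0,t_{L-1}]$; $\hat y_l(V,W)=g(\hat x(t_l;(V,W)))$. Regularization $\rho:\mathcal{P}\to\mathbb{R}$: for any full-column-rank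 $\Phi,\Psi\in\mathbb{R}^{n\times r}$ with $V=\operatorname{Range}\Phi$, $W=\operatorname{Range}\Psi$, $$\rho(V,W)=-\log\left(\frac{\det(\Psi^T\Phi)^2}{\det(\Phi^T\Phi)\det(\Psi^T\Psi)}\right)$$ (independent of the choice of $\Phi,\Psi$). Cost: with $L_y:\mathbb{R}^m\to[0,\infty)$ a smooth function and weight $\gamma>0$, $$J(V,W)=J(V,W;\gamma)=\frac1L\sum_{l=0}^{L-1}L_y(\hat y_l(V,W)-y_l)+\gamma\rho(V,W),\qquad (V,W)\in\mathcal{D}.$$ Standing blow-up assumption: if $\mathcal{D}\ne\mathcal{P}$ and $\{(V_k,W_k)\}_{k\ge1}\subset\mathcal{D}$ is any sequence with $\max_{t\in[t_0,t_{L-1}]}\|\hat x(t;(V_k,W_k))\|\to\infty$ as $k\to\infty$, then $J(V_k,W_k)\to\infty$ (for each weight $\gamma$ considered). "Approaches $\mathcal{D}\cap\mathcal{P}_0$ as $\gamma\to\infty$" means: for every open set $\mathcal{U}\subset\mathcal{D}$ containing $\mathcal{D}\cap\mathcal{P}_0$ there is $\Gamma>0$ such that $(V_{\mathrm{op}}(\gamma),W_{\mathrm{op}}(\gamma))\in\mathcal{U}$ for all $\gamma\ge\Gamma$. *)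

theory Defs
  imports "HOL-Analysis.Analysis"
begin

section \<open>The Grassmann manifold\<close>

text \<open>
  The subspace dimension $r$ is the cardinality of the index type \<^typ>\<open>'r\<close>, so that an
  $n \times r$ matrix has type \<^typ>\<open>real^'r^'n\<close>.  Constants in whose remaining arguments
  \<^typ>\<open>'r\<close> does not occur take it as an \<open>itself\<close> argument.
\<close>

definition grassmannian :: "'r::finite itself \<Rightarrow> (real^'n) set set" where
  "grassmannian _ = {V. subspace V \<and> dim V = CARD('r)}"

definition full_rank_matrices :: "(real^'r^'n) set" where
  "full_rank_matrices = {\<Phi>. rank \<Phi> = CARD('r)}"

definition mat_range :: "real^'r^'n \<Rightarrow> (real^'n) set" where
  "mat_range \<Phi> = range (\<lambda>z. \<Phi> *v z)"

text \<open>The quotient topology under $\Phi \mapsto \mathrm{Range}\,\Phi$ on matrices of full column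
  rank, which is the topology of the Grassmann manifold as the quotient of these matrices by
  $GL_r$.\<close>

definition grassmann_topology :: "'r::finite itself \<Rightarrow> (real^'n) set topology" where
  "grassmann_topology R = topology (\<lambda>U. U \<subseteq> grassmannian R \<and>
     openin (top_of_set full_rank_matrices)
       {\<Phi> \<in> full_rank_matrices. mat_range (\<Phi> :: real^'r^'n) \<in> U})"

lemma openin_grassmann_topology:
  "openin (grassmann_topology (R :: 'r::finite itself)) U \<longleftrightarrow>
     U \<subseteq> grassmannian R \<and>
     openin (top_of_set full_rank_matrices)
       {\<Phi> \<in> full_rank_matrices. mat_range (\<Phi> :: real^'r^'n) \<in> U}"
proof -
  let ?pre = "\<lambda>U. {\<Phi> \<in> full_rank_matrices. mat_range (\<Phi> :: real^'r^'n) \<in> U}"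
  have "istopology (\<lambda>U. U \<subseteq> grassmannian R \<and> openin (top_of_set full_rank_matrices) (?pre U))"
    unfolding istopology_def
  proof (intro conjI allI impI; (elim conjE)?)
    fix S T
    assume "openin (top_of_set full_rank_matrices) (?pre S)"
      "openin (top_of_set full_rank_matrices) (?pre T)"
    then have "openin (top_of_set full_rank_matrices) (?pre S \<inter> ?pre T)"
      by (rule openin_Int)
    moreover have "?pre S \<inter> ?pre T = ?pre (S \<inter> T)" by auto
    ultimately show "openin (top_of_set full_rank_matrices) (?pre (S \<inter> T))" by simp
  next
    fix \<K>
    assume K: "\<forall>K\<in>\<K>. K \<subseteq> grassmannian R \<and> openin (top_of_set full_rank_matrices) (?pre K)"
    then have "openin (top_of_set full_rank_matrices) (\<Union>(?pre ` \<K>))"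
      by (intro openin_Union) auto
    moreover have "\<Union>(?pre ` \<K>) = ?pre (\<Union>\<K>)" by auto
    ultimately show "openin (top_of_set full_rank_matrices) (?pre (\<Union>\<K>))" by simp
  qed auto
  then show ?thesis
    unfolding grassmann_topology_def by (simp add: topology_inverse')
qed

section \<open>Oblique projections and the regularization\<close>

definition complementary_pairs :: "'r::finite itself \<Rightarrow> ((real^'n) set \<times> (real^'n) set) set" where
  "complementary_pairs R = {(V, W). V \<in> grassmannian R \<and> W \<in> grassmannian R \<and>
     V \<inter> orthogonal_comp W = {0} \<and>
     {v + w | v w. v \<in> V \<and> w \<in> orthogonal_comp W} = UNIV}"

definition oblique_projection :: "(real^'n) set \<Rightarrow> (real^'n) set \<Rightarrow> real^'n \<Rightarrow> real^'n" where
  "oblique_projection V W =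
     (THE P. linear P \<and> P \<circ> P = P \<and> range P = V \<and> {x. P x = 0} = orthogonal_comp W)"

text \<open>The description of \<open>z\<close> determines it uniquely for all complementary pairs, since the
  quotient of determinants is invariant under a change of basis in $V$ or $W$.\<close>

definition rho :: "'r::finite itself \<Rightarrow> (real^'n) set \<Rightarrow> (real^'n) set \<Rightarrow> real" where
  "rho _ V W = (THE z. \<forall>\<Phi> \<in> full_rank_matrices. \<forall>\<Psi> \<in> full_rank_matrices.
     mat_range (\<Phi> :: real^'r^'n) = V \<and> mat_range (\<Psi> :: real^'r^'n) = W \<longrightarrow>
     z = - ln ((det (transpose \<Psi> ** \<Phi>))\<^sup>2 /
               (det (transpose \<Phi> ** \<Phi>) * det (transpose \<Psi> ** \<Psi>))))"

section \<open>Continuous differentiability\<close>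

text \<open>\<open>h x p\<close> has partial derivatives with respect to \<open>x\<close> of all orders \<open>\<le> k\<close>, and these
  (including order zero) are jointly continuous in \<open>(x, p)\<close> on $\mathbb{R}^n \times T$.\<close>

primrec cont_partials ::
  "nat \<Rightarrow> 'p::topological_space set \<Rightarrow> (real^'n \<Rightarrow> 'p \<Rightarrow> 'c::real_normed_vector) \<Rightarrow> bool" where
  "cont_partials 0 T h \<longleftrightarrow> continuous_on (UNIV \<times> T) (\<lambda>(x, p). h x p)"
| "cont_partials (Suc k) T h \<longleftrightarrow> continuous_on (UNIV \<times> T) (\<lambda>(x, p). h x p) \<and>
     (\<forall>i. \<exists>D. (\<forall>x. \<forall>p\<in>T.
            ((\<lambda>s. h (x + s *\<^sub>R axis i 1) p) has_vector_derivative D x p) (at 0)) \<and>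
        cont_partials k T D)"

text \<open>Without a parameter: \<open>h\<close> is of class $C^k$ on $\mathbb{R}^n$.\<close>

definition C_k :: "nat \<Rightarrow> (real^'n \<Rightarrow> 'c::real_normed_vector) \<Rightarrow> bool" where
  "C_k k h \<longleftrightarrow> cont_partials k (UNIV :: real set) (\<lambda>x _. h x)"

definition smooth :: "(real^'n \<Rightarrow> 'c::real_normed_vector) \<Rightarrow> bool" where
  "smooth h \<longleftrightarrow> (\<forall>k. C_k k h)"

section \<open>Full-order and reduced-order models\<close>

text \<open>\<open>\<xi>\<close> solves $\dot\xi = F(\xi, t)$, $\xi(a) = \xi_0$ on $[a, b]$, with one-sided derivatives at the
  end points.\<close>

definition ivp_solution ::
  "(real^'n \<Rightarrow> real \<Rightarrow> real^'n) \<Rightarrow> real^'n \<Rightarrow> real \<Rightarrow> real \<Rightarrow> (real \<Rightarrow> real^'n) \<Rightarrow> bool" where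
  "ivp_solution F \<xi>\<^sub>0 a b \<xi> \<longleftrightarrow> \<xi> a = \<xi>\<^sub>0 \<and>
     (\<forall>t\<in>{a..b}. (\<xi> has_vector_derivative F (\<xi> t) t) (at t within {a..b}))"

definition fom_solution ::
  "(real^'n \<Rightarrow> real^'d \<Rightarrow> real^'n) \<Rightarrow> (real \<Rightarrow> real^'d) \<Rightarrow> real^'n \<Rightarrow> real \<Rightarrow> real \<Rightarrow>
   (real \<Rightarrow> real^'n) \<Rightarrow> bool" where
  "fom_solution f u x\<^sub>0 a b = ivp_solution (\<lambda>x t. f x (u t)) x\<^sub>0 a b"

definition rom_solution ::
  "(real^'n \<Rightarrow> real^'d \<Rightarrow> real^'n) \<Rightarrow> (real \<Rightarrow> real^'d) \<Rightarrow> real^'n \<Rightarrow> real \<Rightarrow> real \<Rightarrow>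
   (real^'n) set \<Rightarrow> (real^'n) set \<Rightarrow> (real \<Rightarrow> real^'n) \<Rightarrow> bool" where
  "rom_solution f u x\<^sub>0 a b V W =
     ivp_solution (\<lambda>x t. oblique_projection V W (f x (u t))) (oblique_projection V W x\<^sub>0) a b"

text \<open>Solutions are total functions in HOL; uniqueness is meant on $[a, b]$ only.\<close>

definition rom_domain ::
  "'r::finite itself \<Rightarrow> (real^'n \<Rightarrow> real^'d \<Rightarrow> real^'n) \<Rightarrow> (real \<Rightarrow> real^'d) \<Rightarrow> real^'n \<Rightarrow>
   real \<Rightarrow> real \<Rightarrow> ((real^'n) set \<times> (real^'n) set) set" where
  "rom_domain R f u x\<^sub>0 a b = {(V, W) \<in> complementary_pairs R.
     \<exists>\<xi>. rom_solution f u x\<^sub>0 a b V W \<xi> \<and>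
       (\<forall>\<zeta>. rom_solution f u x\<^sub>0 a b V W \<zeta> \<longrightarrow> (\<forall>t\<in>{a..b}. \<zeta> t = \<xi> t))}"

text \<open>On \<^const>\<open>rom_domain\<close> the values at times in $[a, b]$ do not depend on the choice made
  by \<open>SOME\<close>.\<close>

definition rom_state ::
  "(real^'n \<Rightarrow> real^'d \<Rightarrow> real^'n) \<Rightarrow> (real \<Rightarrow> real^'d) \<Rightarrow> real^'n \<Rightarrow> real \<Rightarrow> real \<Rightarrow>
   (real^'n) set \<Rightarrow> (real^'n) set \<Rightarrow> real \<Rightarrow> real^'n" where
  "rom_state f u x\<^sub>0 a b V W = (SOME \<xi>. rom_solution f u x\<^sub>0 a b V W \<xi>)"

text \<open>The sample times are \<open>\<tau> 0 < \<dots> < \<tau> (L - 1)\<close>, \<open>y\<close> is the sequence of full-order observations,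
  \<open>Ly\<close> the loss and \<open>\<gamma>\<close> the weight.\<close>

definition rom_cost ::
  "'r::finite itself \<Rightarrow> (real^'n \<Rightarrow> real^'d \<Rightarrow> real^'n) \<Rightarrow> (real \<Rightarrow> real^'d) \<Rightarrow> real^'n \<Rightarrow>
   (real^'n \<Rightarrow> real^'m) \<Rightarrow> nat \<Rightarrow> (nat \<Rightarrow> real) \<Rightarrow> (nat \<Rightarrow> real^'m) \<Rightarrow> (real^'m \<Rightarrow> real) \<Rightarrow>
   real \<Rightarrow> (real^'n) set \<Rightarrow> (real^'n) set \<Rightarrow> real" where
  "rom_cost R f u x\<^sub>0 g L \<tau> y Ly \<gamma> V W =
     1 / real L * (\<Sum>l<L. Ly (g (rom_state f u x\<^sub>0 (\<tau> 0) (\<tau> (L - 1)) V W (\<tau> l)) - y l))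
     + \<gamma> * rho R V W"

text \<open>For pairs in \<^const>\<open>rom_domain\<close> the state is continuous in time, so the supremum below is
  the maximum over $[a, b]$.\<close>

definition blow_up_property ::
  "'r::finite itself \<Rightarrow> (real^'n \<Rightarrow> real^'d \<Rightarrow> real^'n) \<Rightarrow> (real \<Rightarrow> real^'d) \<Rightarrow> real^'n \<Rightarrow>
   real \<Rightarrow> real \<Rightarrow> ((real^'n) set \<Rightarrow> (real^'n) set \<Rightarrow> real) \<Rightarrow> bool" where
  "blow_up_property R f u x\<^sub>0 a b J \<longleftrightarrow>
     (rom_domain R f u x\<^sub>0 a b \<noteq> complementary_pairs R \<longrightarrow>
       (\<forall>V W. (\<forall>k::nat. (V k, W k) \<in> rom_domain R f u x\<^sub>0 a b) \<and>
          filterlim (\<lambda>k. SUP t\<in>{a..b}. norm (rom_state f u x\<^sub>0 a b (V k) (W k) t))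
            at_top sequentially \<longrightarrow>
          filterlim (\<lambda>k. J (V k) (W k)) at_top sequentially))"

definition is_minimizer ::
  "('a \<Rightarrow> 'b \<Rightarrow> real) \<Rightarrow> ('a \<times> 'b) set \<Rightarrow> 'a \<Rightarrow> 'b \<Rightarrow> bool" where
  "is_minimizer J D V W \<longleftrightarrow> (V, W) \<in> D \<and> (\<forall>(V', W')\<in>D. J V W \<le> J V' W')"

end

theory Submission
  imports Defs
begin

text \<open>
  A sequence of pairs with bounded cost has bounded regularization, so the orthonormal frames of its
  subspaces have, by compactness, a limit at which the determinant of the overlap is still nonzero:
  the limit is a complementary pair and the projections converge.  The blow-up assumption bounds the
  states along a subsequence, and Gronwall's inequality turns convergence of the projections into
  convergence of the states, so the limit lies in the domain and the cost passes to the limit.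
  Minimizers arise as limits of minimizing sequences.  Along minimizers for weights tending to
  infinity the regularization tends to zero, and it vanishes only for equal subspaces: the overlap
  of two frames is a contraction, and a contraction of determinant of modulus one is an isometry.
\<close>

section \<open>Dependence of solutions on the projection matrix\<close>

text \<open>The obstacle is that no bound on the states is available a priori: the blow-up
  assumption says nothing when every complementary pair lies in the domain, and otherwise, read
  contrapositively, it bounds the states only along a subsequence. Hence two separate limit results
  for initial value problems. \<open>ivp_solution_limit_exists\<close> starts from a uniform bound
  and produces a solution for the limit matrix; \<open>ivp_solution_convergence\<close> starts from
  such a solution and derives the bound itself, so it gives convergence of the states in either
  case. One matrix carries all dependence on the pair, since the projection multiplies the field and
  the initial state alike. Convergence in the Grassmann topology always comes from convergent
  frames. The facts on contractions are obtained from the Leibniz formula, Cramer's rule and matrix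
  powers, with constants that depend on the dimension only. For weights at least 1, nonnegativity of
  \<open>rho\<close> makes the cost at weight 1 a lower bound of the cost, so compactness at weight
  1 serves the whole family of minimizers.\<close>

lemma cont_partials_continuous:
  "cont_partials k T h \<Longrightarrow> continuous_on (UNIV \<times> T) (\<lambda>(x, p). h x p)"
  by (cases k) auto

lemma C_k_continuous:
  assumes "C_k k h"
  shows "continuous_on UNIV h"
proof -
  have "continuous_on (UNIV \<times> (UNIV :: real set)) (\<lambda>(x, p). h x)"
    using assms unfolding C_k_def by (rule cont_partials_continuous)
  then have "continuous_on UNIV ((\<lambda>(x, p). h x) \<circ> (\<lambda>x. (x, 0 :: real)))"
    by (intro continuous_on_compose continuous_intros) (auto elim: continuous_on_subset)
  then show ?thesis
    by (simp add: o_def)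
qed

lemma bounded_on_compact_times:
  assumes "continuous_on (UNIV \<times> T) (\<lambda>(x, p). h x p)" "compact S" "compact T"
  obtains B where "\<And>x p. x \<in> S \<Longrightarrow> p \<in> T \<Longrightarrow> norm (h x p) \<le> B"
proof -
  have "compact ((\<lambda>(x, p). h x p) ` (S \<times> T))"
    by (intro compact_continuous_image compact_Times assms continuous_on_subset[OF assms(1)]) auto
  then obtain B where "\<forall>z \<in> (\<lambda>(x, p). h x p) ` (S \<times> T). norm z \<le> B"
    using compact_imp_bounded bounded_iff by blast
  then show thesis
    by (intro that[of B]) auto
qed

text \<open>Moves from \<open>x\<close> to \<open>y\<close> one coordinate at a time, staying in a cube around the ball.\<close>

lemma cont_partials_imp_lipschitz:
  fixes h :: "real^'n \<Rightarrow> 'p::topological_space \<Rightarrow> 'c::real_normed_vector"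
  assumes h: "cont_partials (Suc k) T h" and T: "compact T"
  obtains K where "0 \<le> K"
    "\<And>x y p. \<lbrakk>p \<in> T; norm x \<le> M; norm y \<le> M\<rbrakk> \<Longrightarrow> norm (h x p - h y p) \<le> K * norm (x - y)"
proof -
  from h have "\<forall>i. \<exists>D. (\<forall>x. \<forall>p\<in>T.
            ((\<lambda>s. h (x + s *\<^sub>R axis i 1) p) has_vector_derivative D x p) (at 0)) \<and>
        cont_partials k T D"
    by simp
  then obtain D where D: "\<And>i x p. p \<in> T \<Longrightarrow>
            ((\<lambda>s. h (x + s *\<^sub>R axis i 1) p) has_vector_derivative D i x p) (at 0)"
        and cD: "\<And>i. cont_partials k T (D i)"
    by metis
  \<comment> \<open>A vector with some coordinates from \<open>x\<close> and the others from
    \<open>y\<close> may leave the ball of radius \<open>M\<close>, but each of its coordinates is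
    still at most \<open>M\<close> in absolute value.\<close>
  define C :: "(real^'n) set" where "C = cbox (\<chi> i. - M) (\<chi> i. M)"
  have C_iff: "z \<in> C \<longleftrightarrow> (\<forall>i. \<bar>z $ i\<bar> \<le> M)" for z
    unfolding C_def mem_box_cart by (auto simp: abs_le_iff)  (smt (verit))+
  have "compact C" by (simp add: C_def)
  have "\<forall>i. \<exists>b. \<forall>x p. x \<in> C \<longrightarrow> p \<in> T \<longrightarrow> norm (D i x p) \<le> b"
    using bounded_on_compact_times[OF cont_partials_continuous[OF cD] \<open>compact C\<close> T] by metis
  then obtain b where b: "\<And>i x p. x \<in> C \<Longrightarrow> p \<in> T \<Longrightarrow> norm (D i x p) \<le> b i"
    by metis
  define B where "B = (\<Sum>i\<in>UNIV. \<bar>b i\<bar>)"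
  have B0: "0 \<le> B" by (simp add: B_def sum_nonneg)
  have B: "norm (D i x p) \<le> B" if "x \<in> C" "p \<in> T" for i x p
  proof -
    have "norm (D i x p) \<le> \<bar>b i\<bar>" using b[OF that, of i] by simp
    also have "\<dots> \<le> B" unfolding B_def by (rule member_le_sum) auto
    finally show ?thesis .
  qed
  have step: "norm (h (z + s *\<^sub>R axis i 1) p - h z p) \<le> B * \<bar>s\<bar>"
    if p: "p \<in> T" and z: "z \<in> C" and zs: "z + s *\<^sub>R axis i 1 \<in> C" for z s i p
  proof -
    let ?\<phi> = "\<lambda>r. h (z + r *\<^sub>R axis i 1) p"
    \<comment> \<open>The hypothesis differentiates along an axis at parameter 0 only; moving the
      base point to \<open>z + r *\<^sub>R axis i 1\<close> turns this into a derivative at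
      \<open>r\<close>.\<close>
    have deriv: "(?\<phi> has_vector_derivative D i (z + r *\<^sub>R axis i 1) p) (at r)" for r
    proof -
      have 1: "((\<lambda>q. q - r) has_vector_derivative 1) (at r)"
        by (auto intro!: derivative_eq_intros)
      have 2: "((\<lambda>q. h ((z + r *\<^sub>R axis i 1) + q *\<^sub>R axis i 1) p) has_vector_derivative
            D i (z + r *\<^sub>R axis i 1) p) (at (r - r))"
        using D[OF p, of "z + r *\<^sub>R axis i 1" i] by simp
      from vector_diff_chain_at[OF 1 2] show ?thesis
        by (simp add: o_def scaleR_left_diff_distrib)
    qed
    have inC: "z + r *\<^sub>R axis i 1 \<in> C" if r: "r \<in> closed_segment 0 s" for r
      unfolding C_iff
    proof
      fix j
      have 1: "\<bar>z $ j\<bar> \<le> M" "\<bar>z $ j + s * (axis i 1 :: real^'n) $ j\<bar> \<le> M"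
        using z zs unfolding C_iff by (auto dest: spec[of _ j])
      show "\<bar>(z + r *\<^sub>R axis i 1) $ j\<bar> \<le> M"
        using 1 r by (cases "i = j") (auto simp: axis_def closed_segment_eq_real_ivl split: if_splits)
    qed
    have "norm (?\<phi> s - ?\<phi> 0) \<le> B * norm (s - 0)"
    proof (rule differentiable_bound[where S = "closed_segment 0 s"])
      fix r assume r: "r \<in> closed_segment 0 s"
      show "(?\<phi> has_derivative (\<lambda>q. q *\<^sub>R D i (z + r *\<^sub>R axis i 1) p)) (at r within closed_segment 0 s)"
        using has_vector_derivative_at_within[OF deriv] unfolding has_vector_derivative_def .
      show "onorm (\<lambda>q. q *\<^sub>R D i (z + r *\<^sub>R axis i 1) p) \<le> B"
        by (rule onorm_bound[OF B0])
           (use B[OF inC[OF r] p] in \<open>simp add: mult.commute[of B] mult_left_mono\<close>)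
    qed auto
    then show ?thesis by simp
  qed
  define mix where "mix x y S = (\<chi> i. if i \<in> S then y $ i else x $ i)"
    for x y :: "real^'n" and S :: "'n set"
  have tele: "norm (h (mix x y S) p - h x p) \<le> B * (\<Sum>i\<in>S. \<bar>y $ i - x $ i\<bar>)"
    if p: "p \<in> T" and x: "x \<in> C" and y: "y \<in> C" for x y p S
    using finite[of S]
  proof (induction S)
    case empty
    have "mix x y {} = x" by (simp add: mix_def vec_eq_iff)
    then show ?case by simp
  next
    case (insert i S)
    have eq: "mix x y (insert i S) = mix x y S + (y $ i - x $ i) *\<^sub>R axis i 1"
      using insert.hyps by (auto simp: mix_def vec_eq_iff axis_def)
    have "mix x y S' \<in> C" for S'
      using x y unfolding C_iff mix_def by auto
    then have "norm (h (mix x y (insert i S)) p - h (mix x y S) p) \<le> B * \<bar>y $ i - x $ i\<bar>"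
      using step[OF p, of "mix x y S" "y $ i - x $ i" i] eq by metis
    then have "norm (h (mix x y (insert i S)) p - h x p)
        \<le> B * \<bar>y $ i - x $ i\<bar> + B * (\<Sum>i\<in>S. \<bar>y $ i - x $ i\<bar>)"
      using insert.IH norm_diff_triangle_le by blast
    then show ?case
      using insert.hyps by (simp add: algebra_simps)
  qed
  show thesis
  proof (rule that[of "B * CARD('n)"])
    fix x y :: "real^'n" and p
    assume p: "p \<in> T" and x: "norm x \<le> M" and y: "norm y \<le> M"
    have "x \<in> C" "y \<in> C"
      using x y component_le_norm_cart order_trans unfolding C_iff by blast+
    from tele[OF p this(2,1), of UNIV] have "norm (h x p - h y p) \<le> B * (\<Sum>i\<in>UNIV. \<bar>x $ i - y $ i\<bar>)"
      by (simp add: mix_def)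
    also have "(\<Sum>i\<in>UNIV. \<bar>x $ i - y $ i\<bar>) \<le> (\<Sum>i\<in>(UNIV :: 'n set). norm (x - y))"
      by (rule sum_mono) (metis component_le_norm_cart vector_minus_component)
    finally show "norm (h x p - h y p) \<le> B * CARD('n) * norm (x - y)"
      using B0 by (simp add: mult_left_mono mult.assoc)
  qed (use B0 in auto)
qed

section \<open>Gronwall estimate and initial value problems with a matrix factor\<close>

lemma norm_matrix_vector_mult_le: "norm (A *v x) \<le> norm A * norm x"
  for A :: "real^'n^'m"
proof -
  have "norm (A *v x) = L2_set (\<lambda>i. \<bar>A $ i \<bullet> x\<bar>) UNIV"
    by (simp add: norm_vec_def matrix_vector_mult_def inner_vec_def)
  also have "\<dots> \<le> L2_set (\<lambda>i. norm (A $ i) * norm x) UNIV"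
    by (intro L2_set_mono) (auto simp: Cauchy_Schwarz_ineq2)
  also have "\<dots> = norm A * norm x"
    by (simp add: norm_vec_def[of A] L2_set_left_distrib)
  finally show ?thesis .
qed

text \<open>The square of the norm is used since it is differentiable at zero.\<close>

lemma gronwall_square:
  fixes \<phi> :: "real \<Rightarrow> 'a::real_inner"
  assumes deriv: "\<And>t. t \<in> {a..b} \<Longrightarrow> (\<phi> has_vector_derivative \<phi>' t) (at t within {a..b})"
    and bound: "\<And>t. t \<in> {a..b} \<Longrightarrow> norm (\<phi>' t) \<le> K * norm (\<phi> t) + e"
    and init: "norm (\<phi> a) \<le> e" and K: "0 \<le> K" and t: "t \<in> {a..b}"
  shows "(norm (\<phi> t))\<^sup>2 \<le> 2 * e\<^sup>2 * exp ((2 * K + 1) * (t - a))"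
proof -
  \<comment> \<open>Adding \<open>e\<^sup>2\<close> absorbs the forcing term: by \<open>2 * norm
    (\<phi> s) * e \<le> (norm (\<phi> s))\<^sup>2 + e\<^sup>2\<close>, the sum grows at rate at
    most \<open>2 * K + 1\<close>, so the integrating factor makes \<open>N\<close> nonincreasing.
    The factor 2 in the conclusion is the bound of \<open>N a\<close> by
    \<open>2 * e\<^sup>2\<close>.\<close>
  define N where "N s = (\<phi> s \<bullet> \<phi> s + e\<^sup>2) * exp (- (2 * K + 1) * (s - a))" for s
  have cont: "continuous_on {a..b} \<phi>"
    using deriv has_vector_derivative_continuous continuous_on_eq_continuous_within by blast
  have "N t \<le> N a"
  proof (rule DERIV_nonpos_imp_decreasing_open[where f = N])
    show "a \<le> t" using t by simp
    show "continuous_on {a..t} N"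
      unfolding N_def
      by (intro continuous_intros continuous_on_subset[OF cont]) (use t in auto)
    fix s assume s: "a < s" "s < t"
    have d: "(\<phi> has_vector_derivative \<phi>' s) (at s)"
      using deriv[of s] at_within_Icc_at[of a s b] s t by simp
    have d2: "((\<lambda>s. \<phi> s \<bullet> \<phi> s) has_real_derivative 2 * (\<phi> s \<bullet> \<phi>' s)) (at s)"
      using bounded_bilinear.has_vector_derivative[OF bounded_bilinear_inner d d]
      by (simp add: has_real_derivative_iff_has_vector_derivative inner_commute)
    let ?X = "exp (- (2 * K + 1) * (s - a))"
    have "(N has_real_derivative 2 * (\<phi> s \<bullet> \<phi>' s) * ?X + (\<phi> s \<bullet> \<phi> s + e\<^sup>2) * (?X * - (2 * K + 1))) (at s)"
      unfolding N_def by (auto intro!: derivative_eq_intros d2)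
    moreover have "2 * (\<phi> s \<bullet> \<phi>' s) * ?X + (\<phi> s \<bullet> \<phi> s + e\<^sup>2) * (?X * - (2 * K + 1)) \<le> 0"
    proof -
      have "\<phi> s \<bullet> \<phi>' s \<le> norm (\<phi> s) * norm (\<phi>' s)" by (rule norm_cauchy_schwarz)
      also have "\<dots> \<le> norm (\<phi> s) * (K * norm (\<phi> s) + e)"
        using bound[of s] s t by (intro mult_left_mono) auto
      finally have "2 * (\<phi> s \<bullet> \<phi>' s) \<le> 2 * K * (norm (\<phi> s))\<^sup>2 + 2 * norm (\<phi> s) * e"
        by (simp add: algebra_simps power2_eq_square)
      also have "2 * norm (\<phi> s) * e \<le> (norm (\<phi> s))\<^sup>2 + e\<^sup>2"
        by (rule sum_squares_bound)
      also have "2 * K * (norm (\<phi> s))\<^sup>2 + ((norm (\<phi> s))\<^sup>2 + e\<^sup>2) \<le> (2 * K + 1) * ((norm (\<phi> s))\<^sup>2 + e\<^sup>2)"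
        using K by (simp add: algebra_simps)
      finally have "2 * (\<phi> s \<bullet> \<phi>' s) - (2 * K + 1) * (\<phi> s \<bullet> \<phi> s + e\<^sup>2) \<le> 0"
        by (simp add: power2_norm_eq_inner)
      then have "(2 * (\<phi> s \<bullet> \<phi>' s) - (2 * K + 1) * (\<phi> s \<bullet> \<phi> s + e\<^sup>2)) * ?X \<le> 0"
        by (rule mult_nonpos_nonneg) simp
      then show ?thesis by (simp add: algebra_simps)
    qed
    ultimately show "\<exists>y. DERIV N s :> y \<and> y \<le> 0" by blast
  qed
  also have "N a \<le> 2 * e\<^sup>2"
    using power_mono[OF init, of 2] by (simp add: N_def power2_norm_eq_inner)
  finally have "(\<phi> t \<bullet> \<phi> t + e\<^sup>2) \<le> 2 * e\<^sup>2 * exp ((2 * K + 1) * (t - a))"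
    unfolding N_def minus_mult_left[symmetric] exp_minus by (simp add: field_simps)
  moreover have "\<phi> t \<bullet> \<phi> t \<le> \<phi> t \<bullet> \<phi> t + e\<^sup>2" by simp
  ultimately show ?thesis
    unfolding power2_norm_eq_inner by linarith
qed

lemma ivp_solution_continuous_on:
  "ivp_solution F \<xi>\<^sub>0 a b \<xi> \<Longrightarrow> continuous_on {a..b} \<xi>"
  unfolding ivp_solution_def
  using has_vector_derivative_continuous continuous_on_eq_continuous_within by blast

lemma ivp_solution_bounded:
  assumes "ivp_solution F \<xi>\<^sub>0 a b \<xi>"
  obtains M where "\<And>t. t \<in> {a..b} \<Longrightarrow> norm (\<xi> t) \<le> M"
proof -
  have "bounded (\<xi> ` {a..b})"
    using ivp_solution_continuous_on[OF assms]
    by (intro compact_imp_bounded compact_continuous_image) auto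
  then obtain M where "\<forall>x \<in> \<xi> ` {a..b}. norm x \<le> M"
    unfolding bounded_iff by blast
  then show thesis
    by (intro that[of M]) auto
qed

lemma ivp_solution_restrict:
  "ivp_solution F \<xi>\<^sub>0 a b \<xi> \<Longrightarrow> a \<le> s \<Longrightarrow> s \<le> b \<Longrightarrow> ivp_solution F \<xi>\<^sub>0 a s \<xi>"
  unfolding ivp_solution_def
  by (auto intro!: has_vector_derivative_within_subset[where S = "{a..b}" and T = "{a..s}"])

text \<open>Splitting the difference of the fields as \<open>Q\<close> applied to a difference of
  values of \<open>F\<close>, plus \<open>Q - Q'\<close> applied to \<open>F\<close>, gives
  \<open>gronwall_square\<close> with Lipschitz constant \<open>q * K\<close> and forcing
  proportional to \<open>norm (Q - Q')\<close>. The order of quantifiers matters: \<open>C\<close>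
  is fixed before the matrices and solutions, hence uniform along sequences, and before the end
  point \<open>s\<close>, so that the estimate can be used on an interval on which the bound
  \<open>M\<close> has just been established.\<close>

lemma ivp_matrix_dependence:
  fixes F :: "real^'n \<Rightarrow> real \<Rightarrow> real^'n"
  assumes F: "cont_partials (Suc k) {a..b} F" and q0: "0 \<le> q"
  shows "\<exists>C\<ge>0. \<forall>(Q :: real^'n^'n) Q' \<xi> \<zeta> s. norm Q \<le> q \<longrightarrow> s \<le> b \<longrightarrow>
    ivp_solution (\<lambda>x t. Q *v F x t) (Q *v x\<^sub>0) a s \<xi> \<longrightarrow>
    ivp_solution (\<lambda>x t. Q' *v F x t) (Q' *v x\<^sub>0) a s \<zeta> \<longrightarrow>
    (\<forall>r\<in>{a..s}. norm (\<xi> r) \<le> M \<and> norm (\<zeta> r) \<le> M) \<longrightarrow>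
    (\<forall>t\<in>{a..s}. norm (\<xi> t - \<zeta> t) \<le> C * norm (Q - Q'))"
proof -
  obtain K where K0: "0 \<le> K" and K: "\<And>x y p. \<lbrakk>p \<in> {a..b}; norm x \<le> M; norm y \<le> M\<rbrakk>
      \<Longrightarrow> norm (F x p - F y p) \<le> K * norm (x - y)"
    using cont_partials_imp_lipschitz[OF F, of M] by auto
  obtain B where B: "\<And>x p. x \<in> cball 0 M \<Longrightarrow> p \<in> {a..b} \<Longrightarrow> norm (F x p) \<le> B"
    using bounded_on_compact_times[OF cont_partials_continuous[OF F], of "cball 0 M"] by auto
  \<comment> \<open>One number dominates both the field on the ball and the initial state, because
    \<open>gronwall_square\<close> takes the same \<open>e\<close> for the forcing and for the
    initial error.\<close>
  define E where "E = \<bar>B\<bar> + norm x\<^sub>0"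
  define C where "C = sqrt (2 * E\<^sup>2 * exp ((2 * (q * K) + 1) * (b - a)))"
  show ?thesis
  proof (intro exI[of _ C] conjI allI impI ballI)
    show "0 \<le> C" by (simp add: C_def)
    fix Q Q' :: "real^'n^'n" and \<xi> \<zeta> s t
    assume Q: "norm Q \<le> q" and sb: "s \<le> b"
      and \<xi>: "ivp_solution (\<lambda>x t. Q *v F x t) (Q *v x\<^sub>0) a s \<xi>"
      and \<zeta>: "ivp_solution (\<lambda>x t. Q' *v F x t) (Q' *v x\<^sub>0) a s \<zeta>"
      and M: "\<forall>r\<in>{a..s}. norm (\<xi> r) \<le> M \<and> norm (\<zeta> r) \<le> M" and t: "t \<in> {a..s}"
    define e where "e = norm (Q - Q') * E"
    let ?\<phi>' = "\<lambda>r. Q *v F (\<xi> r) r - Q' *v F (\<zeta> r) r"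
    have "(norm (\<xi> t - \<zeta> t))\<^sup>2 \<le> 2 * e\<^sup>2 * exp ((2 * (q * K) + 1) * (t - a))"
    proof (rule gronwall_square[where b = s and \<phi>' = ?\<phi>'])
      fix r assume r: "r \<in> {a..s}"
      show "((\<lambda>r. \<xi> r - \<zeta> r) has_vector_derivative ?\<phi>' r) (at r within {a..s})"
        using \<xi> \<zeta> r unfolding ivp_solution_def by (auto intro!: derivative_intros)
      have "?\<phi>' r = Q *v (F (\<xi> r) r - F (\<zeta> r) r) + (Q - Q') *v F (\<zeta> r) r"
        by (simp add: matrix_vector_mult_diff_distrib matrix_vector_mult_diff_rdistrib)
      also have "norm \<dots> \<le> norm Q * norm (F (\<xi> r) r - F (\<zeta> r) r) + norm (Q - Q') * norm (F (\<zeta> r) r)"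
        by (intro norm_triangle_le add_mono norm_matrix_vector_mult_le)
      also have "\<dots> \<le> q * (K * norm (\<xi> r - \<zeta> r)) + norm (Q - Q') * E"
      proof (intro add_mono mult_mono)
        show "norm (F (\<xi> r) r - F (\<zeta> r) r) \<le> K * norm (\<xi> r - \<zeta> r)"
          using K M r sb by auto
        have "norm (F (\<zeta> r) r) \<le> B" using B M r sb by auto
        then show "norm (F (\<zeta> r) r) \<le> E"
          unfolding E_def using norm_ge_zero[of x\<^sub>0] by linarith
      qed (use Q q0 in auto)
      finally show "norm (?\<phi>' r) \<le> q * K * norm (\<xi> r - \<zeta> r) + e"
        by (simp add: e_def mult.assoc)
    next
      have "norm (\<xi> a - \<zeta> a) = norm ((Q - Q') *v x\<^sub>0)"
        using \<xi> \<zeta> unfolding ivp_solution_def by (simp add: matrix_vector_mult_diff_rdistrib)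
      also have "\<dots> \<le> norm (Q - Q') * norm x\<^sub>0"
        by (rule norm_matrix_vector_mult_le)
      also have "\<dots> \<le> e"
        unfolding e_def E_def by (intro mult_left_mono) auto
      finally show "norm (\<xi> a - \<zeta> a) \<le> e" .
    qed (use q0 K0 t in auto)
    also have "\<dots> \<le> 2 * e\<^sup>2 * exp ((2 * (q * K) + 1) * (b - a))"
      using t sb q0 K0 by (intro mult_left_mono) (auto intro!: mult_left_mono)
    also have "\<dots> = (C * norm (Q - Q'))\<^sup>2"
      by (simp add: C_def e_def power_mult_distrib)
    finally show "norm (\<xi> t - \<zeta> t) \<le> C * norm (Q - Q')"
      by (rule power2_le_imp_le) (simp add: C_def)
  qed
qed

text \<open>The dependence estimate with both matrices equal; two solutions on a compact interval
  have a common bound by continuity.\<close>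

lemma ivp_solution_unique:
  fixes F :: "real^'n \<Rightarrow> real \<Rightarrow> real^'n" and Q :: "real^'n^'n"
  assumes F: "cont_partials (Suc k) {a..b} F"
    and \<xi>: "ivp_solution (\<lambda>x t. Q *v F x t) (Q *v x\<^sub>0) a b \<xi>"
    and \<zeta>: "ivp_solution (\<lambda>x t. Q *v F x t) (Q *v x\<^sub>0) a b \<zeta>"
    and t: "t \<in> {a..b}"
  shows "\<xi> t = \<zeta> t"
proof -
  obtain M1 where M1: "\<And>t. t \<in> {a..b} \<Longrightarrow> norm (\<xi> t) \<le> M1"
    using ivp_solution_bounded[OF \<xi>] by blast
  obtain M2 where M2: "\<And>t. t \<in> {a..b} \<Longrightarrow> norm (\<zeta> t) \<le> M2"
    using ivp_solution_bounded[OF \<zeta>] by blast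
  from ivp_matrix_dependence[OF F norm_ge_zero[of Q], of x\<^sub>0 "max M1 M2"]
  obtain C where C: "\<forall>(A :: real^'n^'n) B \<xi> \<zeta> s. norm A \<le> norm Q \<longrightarrow> s \<le> b \<longrightarrow>
    ivp_solution (\<lambda>x t. A *v F x t) (A *v x\<^sub>0) a s \<xi> \<longrightarrow>
    ivp_solution (\<lambda>x t. B *v F x t) (B *v x\<^sub>0) a s \<zeta> \<longrightarrow>
    (\<forall>r\<in>{a..s}. norm (\<xi> r) \<le> max M1 M2 \<and> norm (\<zeta> r) \<le> max M1 M2) \<longrightarrow>
    (\<forall>t\<in>{a..s}. norm (\<xi> t - \<zeta> t) \<le> C * norm (A - B))"
    by (elim exE conjE) (rule that)
  have "\<forall>r\<in>{a..b}. norm (\<xi> r) \<le> max M1 M2 \<and> norm (\<zeta> r) \<le> max M1 M2"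
    using M1 M2 by (simp add: le_max_iff_disj)
  then have "norm (\<xi> t - \<zeta> t) \<le> C * norm (Q - Q)"
    using C[rule_format, OF order_refl order_refl \<xi> \<zeta> _ t] by blast
  then show ?thesis by simp
qed

text \<open>The first time at which the two solutions are at distance one is excluded by the
  dependence estimate on the interval before it.\<close>

lemma ivp_solution_convergence:
  fixes F :: "real^'n \<Rightarrow> real \<Rightarrow> real^'n" and Q :: "nat \<Rightarrow> real^'n^'n"
  assumes F: "cont_partials (Suc k) {a..b} F"
    and Q: "Q \<longlonglongrightarrow> Q'"
    and \<xi>: "\<And>j. ivp_solution (\<lambda>x t. Q j *v F x t) (Q j *v x\<^sub>0) a b (\<xi> j)"
    and \<zeta>: "ivp_solution (\<lambda>x t. Q' *v F x t) (Q' *v x\<^sub>0) a b \<zeta>"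
    and t: "t \<in> {a..b}"
  shows "(\<lambda>j. \<xi> j t) \<longlonglongrightarrow> \<zeta> t"
proof -
  obtain M where M: "\<And>t. t \<in> {a..b} \<Longrightarrow> norm (\<zeta> t) \<le> M"
    using ivp_solution_bounded[OF \<zeta>] by blast
  obtain q where q0: "0 < q" and q: "\<And>j. norm (Q j) \<le> q"
    using convergent_imp_Bseq[OF convergentI[OF Q]] unfolding Bseq_def by blast
  \<comment> \<open>The margin 1 leaves room for the approximating solutions: as long as one stays
    within distance one of \<open>\<zeta>\<close>, its norm is at most \<open>M + 1\<close>, so a
    single \<open>C\<close> works for all of them.\<close>
  from ivp_matrix_dependence[OF F less_imp_le[OF q0], of x\<^sub>0 "M + 1"]
  obtain C where C0: "0 \<le> C" and C: "\<forall>(Q :: real^'n^'n) Q' \<xi> \<zeta> s. norm Q \<le> q \<longrightarrow> s \<le> b \<longrightarrow>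
    ivp_solution (\<lambda>x t. Q *v F x t) (Q *v x\<^sub>0) a s \<xi> \<longrightarrow>
    ivp_solution (\<lambda>x t. Q' *v F x t) (Q' *v x\<^sub>0) a s \<zeta> \<longrightarrow>
    (\<forall>r\<in>{a..s}. norm (\<xi> r) \<le> M + 1 \<and> norm (\<zeta> r) \<le> M + 1) \<longrightarrow>
    (\<forall>t\<in>{a..s}. norm (\<xi> t - \<zeta> t) \<le> C * norm (Q - Q'))"
    by (elim exE conjE) (rule that)
  have lim0: "(\<lambda>j. C * norm (Q j - Q')) \<longlonglongrightarrow> 0"
    using Q by (intro tendsto_mult_right_zero tendsto_norm_zero) (simp add: LIM_zero)
  have init0: "(\<lambda>j. norm (Q j - Q') * norm x\<^sub>0) \<longlonglongrightarrow> 0"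
    using Q by (intro tendsto_mult_left_zero tendsto_norm_zero) (simp add: LIM_zero)
  have close: "norm (\<xi> j t - \<zeta> t) \<le> C * norm (Q j - Q')"
    if small: "C * norm (Q j - Q') < 1" and init: "norm (Q j - Q') * norm x\<^sub>0 < 1" for j
  proof -
    let ?d = "\<lambda>r. norm (\<xi> j r - \<zeta> r)"
    have cont: "continuous_on {a..b} ?d"
      using ivp_solution_continuous_on[OF \<xi>[of j]] ivp_solution_continuous_on[OF \<zeta>]
      by (intro continuous_intros)
    have est: "?d t \<le> C * norm (Q j - Q')"
      if s: "s \<in> {a..b}" and d: "\<And>r. r \<in> {a..s} \<Longrightarrow> ?d r \<le> 1" and t: "t \<in> {a..s}" for s t
    proof (rule C[rule_format, where s = s, OF q _ _ _ _ t])
      show "ivp_solution (\<lambda>x t. Q j *v F x t) (Q j *v x\<^sub>0) a s (\<xi> j)"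
        "ivp_solution (\<lambda>x t. Q' *v F x t) (Q' *v x\<^sub>0) a s \<zeta>"
        using s by (auto intro: ivp_solution_restrict[OF \<xi>] ivp_solution_restrict[OF \<zeta>])
      fix r assume r: "r \<in> {a..s}"
      have "norm (\<xi> j r) \<le> norm (\<zeta> r) + ?d r"
        by (metis norm_triangle_sub)
      moreover have "norm (\<zeta> r) \<le> M" using M r s by simp
      ultimately show "norm (\<xi> j r) \<le> M + 1 \<and> norm (\<zeta> r) \<le> M + 1"
        using d[OF r] by linarith
    qed (use s in auto)
    have "?d r < 1" if r: "r \<in> {a..b}" for r
    proof (rule ccontr)
      assume "\<not> ?d r < 1"
      define S where "S = {r \<in> {a..b}. 1 \<le> ?d r}"
      have "r \<in> S" using \<open>\<not> ?d r < 1\<close> r by (auto simp: S_def)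
      have "closed ({a..b} \<inter> ?d -` {1..})"
        by (intro continuous_closed_preimage cont) auto
      moreover have "S = {a..b} \<inter> ({a..b} \<inter> ?d -` {1..})"
        by (auto simp: S_def)
      ultimately have "compact S"
        by (metis compact_Icc compact_Int_closed)
      then obtain s where sS: "s \<in> S" and smin: "\<And>r. r \<in> S \<Longrightarrow> s \<le> r"
        using compact_attains_inf[of S] \<open>r \<in> S\<close> by auto
      have s: "s \<in> {a..b}" and ds: "1 \<le> ?d s" using sS by (auto simp: S_def)
      have less: "?d r < 1" if "r \<in> {a..b}" "r < s" for r
        using smin[of r] that by (force simp: S_def)
      have "?d a \<le> 1"
      proof -
        have "?d a = norm ((Q j - Q') *v x\<^sub>0)"
          using \<xi>[of j] \<zeta> unfolding ivp_solution_def by (simp add: matrix_vector_mult_diff_rdistrib)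
        also have "\<dots> \<le> norm (Q j - Q') * norm x\<^sub>0"
          by (rule norm_matrix_vector_mult_le)
        finally show ?thesis using init by simp
      qed
      moreover have "continuous_on {a..s} ?d"
        by (rule continuous_on_subset[OF cont]) (use s in auto)
      \<comment> \<open>The choice of \<open>s\<close> gives only \<open>1 \<le> ?d s\<close>,
        whereas \<open>est\<close> needs distance at most one on the closed interval up to
        \<open>s\<close>. The intermediate value theorem supplies a time of distance exactly one,
        and minimality identifies it with \<open>s\<close>.\<close>
      ultimately obtain r where r: "a \<le> r" "r \<le> s" "?d r = 1"
        using IVT'[of ?d a 1 s] ds s by auto
      have "r = s" using smin[of r] r s by (auto simp: S_def)
      with r have "?d s = 1" by simp
      have "?d s \<le> C * norm (Q j - Q')"
        by (rule est[OF s]) (use s less \<open>?d s = 1\<close> in \<open>auto simp: less_le_not_le dest: order.order_iff_strict[THEN iffD1]\<close>)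
      with ds small show False by simp
    qed
    then show ?thesis
      using t by (intro est[of b]) (auto intro: less_imp_le)
  qed
  have "\<forall>\<^sub>F j in sequentially. norm (\<xi> j t - \<zeta> t) \<le> C * norm (Q j - Q')"
    using order_tendstoD(2)[OF lim0 zero_less_one] order_tendstoD(2)[OF init0 zero_less_one]
    by eventually_elim (rule close)
  then have "(\<lambda>j. \<xi> j t - \<zeta> t) \<longlonglongrightarrow> 0"
    using lim0 by (rule Lim_null_comparison)
  then show ?thesis by (simp add: LIM_zero_iff)
qed

text \<open>With a uniform bound the dependence estimate compares any two members of the sequence,
  so the solutions are uniformly Cauchy. Their derivatives then converge uniformly by the Lipschitz
  property of \<open>F\<close>, and uniform convergence of derivatives lets the differential
  equation pass to the limit.\<close>

lemma ivp_solution_limit_exists: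
  fixes F :: "real^'n \<Rightarrow> real \<Rightarrow> real^'n" and Q :: "nat \<Rightarrow> real^'n^'n"
  assumes F: "cont_partials (Suc k) {a..b} F" and ab: "a \<le> b"
    and Q: "Q \<longlonglongrightarrow> Q'"
    and \<xi>: "\<And>j. ivp_solution (\<lambda>x t. Q j *v F x t) (Q j *v x\<^sub>0) a b (\<xi> j)"
    and M: "\<And>j t. t \<in> {a..b} \<Longrightarrow> norm (\<xi> j t) \<le> M"
  obtains \<zeta> where "ivp_solution (\<lambda>x t. Q' *v F x t) (Q' *v x\<^sub>0) a b \<zeta>"
proof -
  obtain q where q0: "0 < q" and q: "\<And>j. norm (Q j) \<le> q"
    using convergent_imp_Bseq[OF convergentI[OF Q]] unfolding Bseq_def by blast
  from ivp_matrix_dependence[OF F less_imp_le[OF q0], of x\<^sub>0 M]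
  obtain C where C0: "0 \<le> C" and C: "\<forall>(Q :: real^'n^'n) Q' \<xi> \<zeta> s. norm Q \<le> q \<longrightarrow> s \<le> b \<longrightarrow>
    ivp_solution (\<lambda>x t. Q *v F x t) (Q *v x\<^sub>0) a s \<xi> \<longrightarrow>
    ivp_solution (\<lambda>x t. Q' *v F x t) (Q' *v x\<^sub>0) a s \<zeta> \<longrightarrow>
    (\<forall>r\<in>{a..s}. norm (\<xi> r) \<le> M \<and> norm (\<zeta> r) \<le> M) \<longrightarrow>
    (\<forall>t\<in>{a..s}. norm (\<xi> t - \<zeta> t) \<le> C * norm (Q - Q'))"
    by (elim exE conjE) (rule that)
  obtain K where K0: "0 \<le> K" and K: "\<And>x y p. \<lbrakk>p \<in> {a..b}; norm x \<le> M; norm y \<le> M\<rbrakk>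
      \<Longrightarrow> norm (F x p - F y p) \<le> K * norm (x - y)"
    using cont_partials_imp_lipschitz[OF F, of M] by auto
  obtain B where B: "\<And>x p. x \<in> cball 0 M \<Longrightarrow> p \<in> {a..b} \<Longrightarrow> norm (F x p) \<le> B"
    using bounded_on_compact_times[OF cont_partials_continuous[OF F], of "cball 0 M"] by auto
  have gap: "norm (\<xi> i t - \<xi> j t) \<le> C * norm (Q i - Q j)" if "t \<in> {a..b}" for i j t
    by (rule C[rule_format, OF q order_refl \<xi> \<xi> _ that]) (intro conjI M)
  have "Cauchy (\<lambda>j. \<xi> j t)" if t: "t \<in> {a..b}" for t
    unfolding Cauchy_iff
  proof (intro allI impI)
    fix e :: real assume e: "0 < e"
    have "Cauchy Q" using Q convergent_Cauchy convergentI by blast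
    \<comment> \<open>Dividing by \<open>C + 1\<close> rather than \<open>C\<close> covers
      \<open>C = 0\<close>.\<close>
    moreover have "0 < e / (C + 1)" using e C0 by simp
    ultimately obtain N where N: "\<And>m n. N \<le> m \<Longrightarrow> N \<le> n \<Longrightarrow> norm (Q m - Q n) < e / (C + 1)"
      unfolding Cauchy_iff by meson
    have "norm (\<xi> m t - \<xi> n t) < e" if "N \<le> m" "N \<le> n" for m n
    proof -
      have "norm (\<xi> m t - \<xi> n t) \<le> C * norm (Q m - Q n)" by (rule gap[OF t])
      also have "\<dots> \<le> (C + 1) * norm (Q m - Q n)" by (simp add: mult_right_mono)
      also have "\<dots> < e" using N[OF that] C0 by (simp add: field_simps)
      finally show ?thesis .
    qed
    then show "\<exists>N. \<forall>m\<ge>N. \<forall>n\<ge>N. norm (\<xi> m t - \<xi> n t) < e" by blast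
  qed
  then have "\<forall>t. \<exists>z. t \<in> {a..b} \<longrightarrow> (\<lambda>j. \<xi> j t) \<longlonglongrightarrow> z"
    using Cauchy_convergent convergent_def by blast
  then obtain \<zeta> where \<zeta>: "\<And>t. t \<in> {a..b} \<Longrightarrow> (\<lambda>j. \<xi> j t) \<longlonglongrightarrow> \<zeta> t"
    by metis
  have \<zeta>M: "norm (\<zeta> t) \<le> M" if t: "t \<in> {a..b}" for t
    using Lim_norm_ubound[OF _ \<zeta>[OF t]] M[OF t] by simp
  have gap\<zeta>: "norm (\<xi> j t - \<zeta> t) \<le> C * norm (Q j - Q')" if t: "t \<in> {a..b}" for j t
  proof (rule tendsto_le[OF sequentially_bot])
    show "(\<lambda>i. norm (\<xi> j t - \<xi> i t)) \<longlonglongrightarrow> norm (\<xi> j t - \<zeta> t)"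
      by (intro tendsto_intros \<zeta> t)
    show "(\<lambda>i. C * norm (Q j - Q i)) \<longlonglongrightarrow> C * norm (Q j - Q')"
      by (intro tendsto_intros Q)
  qed (simp add: gap[OF t])
  let ?A = "\<lambda>j. norm (Q j - Q')"
  have field_gap: "norm (Q j *v F (\<xi> j t) t - Q' *v F (\<zeta> t) t) \<le> (q * (K * C) + \<bar>B\<bar>) * ?A j"
    if t: "t \<in> {a..b}" for j t
  proof -
    have "Q j *v F (\<xi> j t) t - Q' *v F (\<zeta> t) t
        = Q j *v (F (\<xi> j t) t - F (\<zeta> t) t) + (Q j - Q') *v F (\<zeta> t) t"
      by (simp add: matrix_vector_mult_diff_distrib matrix_vector_mult_diff_rdistrib)
    also have "norm \<dots> \<le> norm (Q j) * norm (F (\<xi> j t) t - F (\<zeta> t) t) + ?A j * norm (F (\<zeta> t) t)"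
      by (intro norm_triangle_le add_mono norm_matrix_vector_mult_le)
    also have "\<dots> \<le> q * (K * (C * ?A j)) + ?A j * \<bar>B\<bar>"
    proof (intro add_mono mult_mono q)
      have "norm (F (\<xi> j t) t - F (\<zeta> t) t) \<le> K * norm (\<xi> j t - \<zeta> t)"
        using K M \<zeta>M t by auto
      also have "\<dots> \<le> K * (C * ?A j)"
        by (rule mult_left_mono[OF gap\<zeta>[OF t] K0])
      finally show "norm (F (\<xi> j t) t - F (\<zeta> t) t) \<le> K * (C * ?A j)" .
      have "norm (F (\<zeta> t) t) \<le> B" using B \<zeta>M t by auto
      then show "norm (F (\<zeta> t) t) \<le> \<bar>B\<bar>" by linarith
    qed (use q0 in auto)
    finally show ?thesis by (simp add: algebra_simps)
  qed
  have "\<exists>\<eta>. \<forall>t\<in>{a..b}. (\<lambda>j. \<xi> j t) \<longlonglongrightarrow> \<eta> t \<and>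
      (\<eta> has_derivative (\<lambda>h. h *\<^sub>R (Q' *v F (\<zeta> t) t))) (at t within {a..b})"
  proof (rule has_derivative_sequence[where f' = "\<lambda>j t h. h *\<^sub>R (Q j *v F (\<xi> j t) t)" and ?x0.0 = a])
    show "\<And>j t. t \<in> {a..b} \<Longrightarrow>
        (\<xi> j has_derivative (\<lambda>h. h *\<^sub>R (Q j *v F (\<xi> j t) t))) (at t within {a..b})"
      using \<xi> unfolding ivp_solution_def has_vector_derivative_def by blast
    show "(\<lambda>j. \<xi> j a) \<longlonglongrightarrow> \<zeta> a" using \<zeta> ab by simp
    fix e :: real assume e: "0 < e"
    have "(\<lambda>j. (q * (K * C) + \<bar>B\<bar>) * ?A j) \<longlonglongrightarrow> 0"
      using Q by (intro tendsto_mult_right_zero tendsto_norm_zero) (simp add: LIM_zero)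
    then have "\<forall>\<^sub>F j in sequentially. (q * (K * C) + \<bar>B\<bar>) * ?A j < e"
      using e by (rule order_tendstoD(2))
    then show "\<forall>\<^sub>F j in sequentially. \<forall>t\<in>{a..b}. \<forall>h.
        norm (h *\<^sub>R (Q j *v F (\<xi> j t) t) - h *\<^sub>R (Q' *v F (\<zeta> t) t)) \<le> e * norm h"
    proof (rule eventually_mono, intro ballI allI)
      fix j t and h :: real assume j: "(q * (K * C) + \<bar>B\<bar>) * ?A j < e" and t: "t \<in> {a..b}"
      have "norm (Q j *v F (\<xi> j t) t - Q' *v F (\<zeta> t) t) \<le> e"
        using field_gap[OF t, of j] j by linarith
      then show "norm (h *\<^sub>R (Q j *v F (\<xi> j t) t) - h *\<^sub>R (Q' *v F (\<zeta> t) t)) \<le> e * norm h"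
        unfolding scaleR_diff_right[symmetric] norm_scaleR
        by (simp add: mult.commute[of e] mult_left_mono)
    qed
  qed (use ab in auto)
  then obtain \<eta> where \<eta>: "\<And>t. t \<in> {a..b} \<Longrightarrow> (\<lambda>j. \<xi> j t) \<longlonglongrightarrow> \<eta> t"
    "\<And>t. t \<in> {a..b} \<Longrightarrow> (\<eta> has_vector_derivative Q' *v F (\<zeta> t) t) (at t within {a..b})"
    unfolding has_vector_derivative_def by blast
  \<comment> \<open>\<open>has_derivative_sequence\<close> returns a limit function of its own,
    while the right-hand side of its derivative is written with the pointwise limit
    \<open>\<zeta>\<close>. Uniqueness of limits makes the two agree on the interval.\<close>
  have eq: "\<eta> t = \<zeta> t" if "t \<in> {a..b}" for t
    using LIMSEQ_unique[OF \<eta>(1) \<zeta>] that by blast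
  have init: "\<eta> a = Q' *v x\<^sub>0"
  proof (rule LIMSEQ_unique)
    show "(\<lambda>j. \<xi> j a) \<longlonglongrightarrow> \<eta> a" using \<eta>(1) ab by simp
    have "(\<lambda>j. Q j *v x\<^sub>0) \<longlonglongrightarrow> Q' *v x\<^sub>0"
    proof (rule LIM_zero_cancel, rule Lim_null_comparison)
      show "\<forall>\<^sub>F j in sequentially. norm (Q j *v x\<^sub>0 - Q' *v x\<^sub>0) \<le> ?A j * norm x\<^sub>0"
        by (simp add: matrix_vector_mult_diff_rdistrib[symmetric] norm_matrix_vector_mult_le)
      show "(\<lambda>j. ?A j * norm x\<^sub>0) \<longlonglongrightarrow> 0"
        using Q by (intro tendsto_mult_left_zero tendsto_norm_zero) (simp add: LIM_zero)
    qed
    then show "(\<lambda>j. \<xi> j a) \<longlonglongrightarrow> Q' *v x\<^sub>0"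
      using \<xi> unfolding ivp_solution_def by simp
  qed
  have "ivp_solution (\<lambda>x t. Q' *v F x t) (Q' *v x\<^sub>0) a b \<eta>"
    unfolding ivp_solution_def using init \<eta>(2) eq by simp
  then show thesis by (rule that)
qed

section \<open>Orthonormal frames and oblique projections\<close>

text \<open>On orthonormal frames both Gram determinants in \<open>rho\<close> equal one, so only
  the overlap determinant remains.\<close>

definition stiefel :: "(real^'r^'n) set" where
  "stiefel = {\<Phi>. transpose \<Phi> ** \<Phi> = mat 1}"

lemma inner_matrix_vector_mult: "(A *v x) \<bullet> y = x \<bullet> (transpose A *v y)"
  for A :: "real^'n^'m"
  by (metis dot_lmul_matrix inner_commute vector_transpose_matrix)

lemma stiefel_left_inverse: "\<Phi> \<in> stiefel \<Longrightarrow> transpose \<Phi> *v (\<Phi> *v z) = z"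
  unfolding stiefel_def by (simp add: matrix_vector_mul_assoc)

lemma stiefel_norm: "\<Phi> \<in> stiefel \<Longrightarrow> norm (\<Phi> *v z) = norm z"
  by (simp add: norm_eq_sqrt_inner inner_matrix_vector_mult stiefel_left_inverse del: transpose_matrix_vector)

text \<open>By adjointness, Cauchy-Schwarz and the isometry of \<open>\<Phi>\<close>, the square of
  the left-hand side is at most the left-hand side times \<open>norm x\<close>.\<close>

lemma stiefel_norm_transpose_le:
  assumes "\<Phi> \<in> stiefel"
  shows "norm (transpose \<Phi> *v x) \<le> norm x"
proof -
  have "(norm (transpose \<Phi> *v x))\<^sup>2 = (\<Phi> *v (transpose \<Phi> *v x)) \<bullet> x"
    by (simp add: inner_matrix_vector_mult power2_norm_eq_inner)
  also have "\<dots> \<le> norm (transpose \<Phi> *v x) * norm x"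
    using norm_cauchy_schwarz stiefel_norm[OF assms] by metis
  finally show ?thesis
    by (cases "transpose \<Phi> *v x = 0") (auto simp: power2_eq_square)
qed

lemma stiefel_full_rank: "stiefel \<subseteq> full_rank_matrices"
proof
  fix \<Phi> :: "real^'r^'n" assume "\<Phi> \<in> stiefel"
  then have "inj ((*v) \<Phi>)"
    by (intro inj_on_inverseI[of _ "\<lambda>x. transpose \<Phi> *v x"]) (rule stiefel_left_inverse)
  then show "\<Phi> \<in> full_rank_matrices"
    by (simp add: full_rank_matrices_def full_rank_injective)
qed

lemma mat_range_in_grassmannian:
  fixes R :: "'r::finite itself" and \<Phi> :: "real^'r^'n"
  assumes "\<Phi> \<in> full_rank_matrices"
  shows "mat_range \<Phi> \<in> grassmannian R"
  using assms unfolding full_rank_matrices_def grassmannian_def mat_range_def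
  by (simp add: rank_dim_range linear_subspace_image)

lemma grassmannian_frame:
  fixes R :: "'r::finite itself" and V :: "(real^'n) set"
  assumes "V \<in> grassmannian R"
  obtains \<Phi> :: "real^'r^'n" where "\<Phi> \<in> stiefel" "mat_range \<Phi> = V"
proof -
  have V: "subspace V" "dim V = CARD('r)"
    using assms by (auto simp: grassmannian_def)
  obtain B where B: "B \<subseteq> V" "pairwise orthogonal B" "\<And>x. x \<in> B \<Longrightarrow> norm x = 1"
    "independent B" "card B = dim V" "span B = V"
    using orthonormal_basis_subspace[OF V(1)] by blast
  have "finite B" using B(4) independent_imp_finite by blast
  then obtain b where b: "bij_betw b (UNIV :: 'r set) B"
    using B(5) V(2) finite_same_card_bij[of "UNIV :: 'r set" B] by auto
  define \<Phi> :: "real^'r^'n" where "\<Phi> = (\<chi> i j. b j $ i)"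
  have mult: "\<Phi> *v z = (\<Sum>j\<in>UNIV. z $ j *\<^sub>R b j)" for z
    by (simp add: vec_eq_iff matrix_vector_mult_def \<Phi>_def mult.commute)
  have orth: "b i \<bullet> b j = (if i = j then 1 else 0)" for i j
  proof (cases "i = j")
    case True
    have "norm (b j) = 1" using B(3) b by (metis UNIV_I bij_betwE)
    then show ?thesis using True by (simp add: norm_eq_1)
  next
    case False
    have "b i \<in> B" "b j \<in> B" "b i \<noteq> b j"
      using b False by (auto simp: bij_betw_def inj_on_def)
    then show ?thesis
      using B(2) False unfolding pairwise_def orthogonal_def by auto
  qed
  have "(transpose \<Phi> ** \<Phi>) $ i $ j = b i \<bullet> b j" for i j
    by (simp add: matrix_matrix_mult_def transpose_def \<Phi>_def inner_vec_def)
  then have "\<Phi> \<in> stiefel"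
    unfolding stiefel_def by (simp add: vec_eq_iff mat_def orth)
  moreover have "mat_range \<Phi> = V"
  proof -
    have "mat_range \<Phi> \<subseteq> V"
      unfolding mat_range_def using V(1) B(1) b
      by (auto simp: mult bij_betw_def intro!: subspace_sum subspace_scale)
    moreover have "b j \<in> mat_range \<Phi>" for j
    proof -
      have "\<Phi> *v axis j 1 = b j"
        by (simp add: matrix_vector_mult_basis column_def \<Phi>_def)
      then show ?thesis unfolding mat_range_def by (metis rangeI)
    qed
    moreover have "subspace (mat_range \<Phi>)"
      using linear_subspace_image[of "(*v) \<Phi>" UNIV] by (simp add: mat_range_def)
    then have "span B \<subseteq> mat_range \<Phi>"
      using calculation(2) b by (intro span_minimal) (auto simp: bij_betw_def)
    ultimately show ?thesis using B(6) by auto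
  qed
  ultimately show thesis by (rule that)
qed

lemma compact_stiefel: "compact (stiefel :: (real^'r^'n) set)"
proof -
  have "norm \<Phi> \<le> CARD('n) * CARD('r)" if \<Phi>: "\<Phi> \<in> stiefel" for \<Phi> :: "real^'r^'n"
  proof -
    have entry: "\<bar>\<Phi> $ i $ j\<bar> \<le> 1" for i j
    proof -
      have "\<Phi> $ i $ j = (\<Phi> *v axis j 1) $ i"
        by (simp add: matrix_vector_mult_basis column_def)
      also have "\<bar>\<dots>\<bar> \<le> norm (\<Phi> *v axis j 1)" by (rule component_le_norm_cart)
      finally show ?thesis by (simp add: stiefel_norm[OF \<Phi>])
    qed
    have "norm \<Phi> \<le> (\<Sum>i\<in>UNIV. norm (\<Phi> $ i))"
      unfolding norm_vec_def[of \<Phi>] by (rule L2_set_le_sum) simp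
    also have "\<dots> \<le> (\<Sum>i\<in>(UNIV :: 'n set). \<Sum>j\<in>(UNIV :: 'r set). 1)"
      by (intro sum_mono order_trans[OF norm_le_l1_cart]) (rule entry)
    finally show ?thesis by simp
  qed
  then have "bounded (stiefel :: (real^'r^'n) set)"
    unfolding bounded_iff by blast
  moreover have "closed (stiefel :: (real^'r^'n) set)"
    unfolding stiefel_def vec_eq_iff matrix_matrix_mult_def transpose_def
    by simp (intro closed_Collect_all closed_Collect_eq continuous_intros)
  ultimately show ?thesis by (simp add: compact_eq_bounded_closed)
qed

section \<open>Continuity of the determinant, product, transpose and inverse of matrices\<close>

lemma tendsto_det:
  fixes A :: "'b \<Rightarrow> real^'n^'n"
  assumes "(A \<longlongrightarrow> A') F"
  shows "((\<lambda>k. det (A k)) \<longlongrightarrow> det A') F"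
  unfolding det_def by (intro tendsto_intros assms)

lemma tendsto_matrix_mult:
  fixes A :: "'b \<Rightarrow> real^'n^'m" and B :: "'b \<Rightarrow> real^'k^'n"
  assumes "(A \<longlongrightarrow> A') F" "(B \<longlongrightarrow> B') F"
  shows "((\<lambda>k. A k ** B k) \<longlongrightarrow> A' ** B') F"
  unfolding matrix_matrix_mult_def by (intro tendsto_intros assms)

lemma tendsto_transpose:
  fixes A :: "'b \<Rightarrow> real^'n^'m"
  assumes "(A \<longlongrightarrow> A') F"
  shows "((\<lambda>k. transpose (A k)) \<longlongrightarrow> transpose A') F"
  unfolding transpose_def by (intro tendsto_intros assms)

lemma matrix_inv_works:
  fixes A :: "real^'n^'n"
  assumes "det A \<noteq> 0"
  shows "A ** matrix_inv A = mat 1" "matrix_inv A ** A = mat 1"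
proof -
  have "\<exists>B. A ** B = mat 1 \<and> B ** A = mat 1"
    using assms invertible_det_nz unfolding invertible_def by blast
  from someI_ex[OF this] show "A ** matrix_inv A = mat 1" "matrix_inv A ** A = mat 1"
    unfolding matrix_inv_def by auto
qed

text \<open>Writes the entries of the inverse as quotients of determinants, so that continuity of
  inversion reduces to continuity of \<open>det\<close>. Column \<open>j\<close> of the inverse
  solves the linear system with right-hand side \<open>axis j 1\<close>.\<close>

lemma matrix_inv_cramer:
  fixes A :: "real^'n^'n"
  assumes "det A \<noteq> 0"
  shows "matrix_inv A =
    (\<chi> i j. det (\<chi> k l. if l = i then axis j 1 $ k else A $ k $ l) / det A)"
proof -
  have "column j (matrix_inv A) = (\<chi> i. det (\<chi> k l. if l = i then axis j 1 $ k else A $ k $ l) / det A)"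
    for j
    unfolding matrix_vector_mult_basis[symmetric]
    by (subst cramer[OF assms, symmetric])
       (simp add: matrix_vector_mul_assoc matrix_inv_works[OF assms])
  then show ?thesis
    by (simp add: vec_eq_iff column_def)
qed

lemma tendsto_matrix_inv:
  fixes A :: "'b \<Rightarrow> real^'n^'n"
  assumes A: "(A \<longlongrightarrow> A') F" and nz: "det A' \<noteq> 0"
  shows "((\<lambda>k. matrix_inv (A k)) \<longlongrightarrow> matrix_inv A') F"
proof (rule Lim_transform_eventually)
  let ?C = "\<lambda>A :: real^'n^'n. \<chi> i j. det (\<chi> k l. if l = i then axis j 1 $ k else A $ k $ l) / det A"
  have "((\<lambda>k. (if l = i then c else A k $ m $ l)) \<longlongrightarrow> (if l = i then c else A' $ m $ l)) F" for i l m c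
    by (cases "l = i") (auto intro!: tendsto_intros A)
  then show "((\<lambda>k. ?C (A k)) \<longlongrightarrow> matrix_inv A') F"
    unfolding matrix_inv_cramer[OF nz]
    by (intro tendsto_intros tendsto_det A nz)
  \<comment> \<open>Early members may be singular; Cramer's formula represents the inverse only
    eventually, once the determinants follow their nonzero limit.\<close>
  have "\<forall>\<^sub>F k in F. det (A k) \<noteq> 0"
    using tendsto_imp_eventually_ne[OF tendsto_det[OF A] nz] .
  then show "\<forall>\<^sub>F k in F. ?C (A k) = matrix_inv (A k)"
    by eventually_elim (simp add: matrix_inv_cramer)
qed

section \<open>Oblique projections and complementary pairs in terms of frames\<close>

lemma det_eq_0_iff_kernel: "det A = 0 \<longleftrightarrow> (\<exists>x. x \<noteq> 0 \<and> A *v x = 0)"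
  for A :: "real^'n^'n"
  using invertible_det_nz[of A] matrix_left_invertible_ker[of A] invertible_left_inverse[of A] by metis

lemma orthogonal_comp_mat_range:
  "orthogonal_comp (mat_range \<Psi>) = {x. transpose \<Psi> *v x = 0}"
  for \<Psi> :: "real^'r^'n"
proof -
  have "(\<forall>z. z \<bullet> (transpose \<Psi> *v x) = 0) \<longleftrightarrow> transpose \<Psi> *v x = 0" for x
    by (metis inner_eq_zero_iff inner_zero_right)
  then show ?thesis
    unfolding orthogonal_comp_def mat_range_def orthogonal_def
    by (auto simp: inner_matrix_vector_mult)
qed

text \<open>An explicit formula replaces the \<open>THE\<close> description of the projection,
  because it can be seen to depend continuously on the frames.\<close>

definition oblique_matrix :: "real^'r^'n \<Rightarrow> real^'r^'n \<Rightarrow> real^'n^'n" where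
  "oblique_matrix \<Phi> \<Psi> = \<Phi> ** matrix_inv (transpose \<Psi> ** \<Phi>) ** transpose \<Psi>"

lemma oblique_matrix_properties:
  fixes \<Phi> \<Psi> :: "real^'r^'n"
  assumes nz: "det (transpose \<Psi> ** \<Phi>) \<noteq> 0"
  shows "oblique_matrix \<Phi> \<Psi> *v (\<Phi> *v z) = \<Phi> *v z"
    and "oblique_matrix \<Phi> \<Psi> *v x \<in> mat_range \<Phi>"
    and "oblique_matrix \<Phi> \<Psi> *v x = 0 \<longleftrightarrow> transpose \<Psi> *v x = 0"
proof -
  note inv = matrix_inv_works[OF nz]
  have "oblique_matrix \<Phi> \<Psi> ** \<Phi> = \<Phi> ** (matrix_inv (transpose \<Psi> ** \<Phi>) ** (transpose \<Psi> ** \<Phi>))"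
    by (simp add: oblique_matrix_def matrix_mul_assoc)
  then show "oblique_matrix \<Phi> \<Psi> *v (\<Phi> *v z) = \<Phi> *v z"
    by (simp add: inv matrix_vector_mul_assoc)
  show "oblique_matrix \<Phi> \<Psi> *v x \<in> mat_range \<Phi>"
    unfolding oblique_matrix_def mat_range_def by (simp add: matrix_vector_mul_assoc[symmetric])
  \<comment> \<open>Applying \<open>transpose \<Psi>\<close> after the projection changes nothing
    compared with applying it alone, so a vector killed by the projection is killed by
    \<open>transpose \<Psi>\<close>. The converse is read off the rightmost factor of the
    formula.\<close>
  have "transpose \<Psi> ** oblique_matrix \<Phi> \<Psi> =
      ((transpose \<Psi> ** \<Phi>) ** matrix_inv (transpose \<Psi> ** \<Phi>)) ** transpose \<Psi>"
    by (simp add: oblique_matrix_def matrix_mul_assoc)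
  then have "transpose \<Psi> *v x = transpose \<Psi> *v (oblique_matrix \<Phi> \<Psi> *v x)"
    by (simp add: inv matrix_vector_mul_assoc)
  then show "oblique_matrix \<Phi> \<Psi> *v x = 0 \<longleftrightarrow> transpose \<Psi> *v x = 0"
    by (auto simp: oblique_matrix_def matrix_vector_mul_assoc[symmetric])
qed

lemma oblique_projection_eq_matrix:
  fixes \<Phi> \<Psi> :: "real^'r^'n"
  assumes nz: "det (transpose \<Psi> ** \<Phi>) \<noteq> 0"
  shows "oblique_projection (mat_range \<Phi>) (mat_range \<Psi>) = (*v) (oblique_matrix \<Phi> \<Psi>)"
  unfolding oblique_projection_def
proof (rule the_equality)
  let ?P = "(*v) (oblique_matrix \<Phi> \<Psi>)"
  note props = oblique_matrix_properties[OF nz]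
  have fix_range: "?P v = v" if "v \<in> mat_range \<Phi>" for v
    using that props(1) by (auto simp: mat_range_def)
  show "linear ?P \<and> ?P \<circ> ?P = ?P \<and> range ?P = mat_range \<Phi> \<and>
      {x. ?P x = 0} = orthogonal_comp (mat_range \<Psi>)"
  proof (intro conjI)
    show "linear ?P" by simp
    show "?P \<circ> ?P = ?P"
      using fix_range[OF props(2)] by (simp add: fun_eq_iff)
    show "range ?P = mat_range \<Phi>"
      using props(2) by (auto intro: range_eqI[of _ ?P, OF fix_range[symmetric]])
    show "{x. ?P x = 0} = orthogonal_comp (mat_range \<Psi>)"
      by (simp only: props(3) orthogonal_comp_mat_range)
  qed
  fix P :: "real^'n \<Rightarrow> real^'n"
  assume P: "linear P \<and> P \<circ> P = P \<and> range P = mat_range \<Phi> \<and> {x. P x = 0} = orthogonal_comp (mat_range \<Psi>)"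
  \<comment> \<open>Decompose \<open>x\<close> as \<open>?P x\<close> plus a remainder: the
    remainder lies in the common kernel, and \<open>?P x\<close> lies in the range of the idempotent
    \<open>P\<close>, which fixes it.\<close>
  show "P = ?P"
  proof
    fix x
    have idem: "P (P x) = P x" for x using P by (metis comp_apply)
    have "P (x - ?P x) = 0"
    proof -
      have "?P (x - ?P x) = 0"
        by (simp only: matrix_vector_mult_diff_distrib fix_range[OF props(2)]) simp
      then have "x - ?P x \<in> orthogonal_comp (mat_range \<Psi>)"
        by (simp add: props(3) orthogonal_comp_mat_range)
      then show ?thesis using P by blast
    qed
    moreover have "P (?P x) = ?P x"
    proof -
      obtain y where "?P x = P y" using P props(2)[of x] by (metis imageE)
      then show ?thesis using idem by metis
    qed
    ultimately show "P x = ?P x"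
      using P by (metis linear_diff eq_iff_diff_eq_0)
  qed
qed

text \<open>Through the injective \<open>\<Phi>\<close>, a kernel vector of the overlap matrix is
  the same as a nonzero vector of the first space orthogonal to the second. If the overlap is
  invertible, the oblique matrix exists and splits every vector into its image and a remainder in
  the orthogonal complement.\<close>

lemma complementary_pairs_iff_det:
  fixes R :: "'r::finite itself" and \<Phi> \<Psi> :: "real^'r^'n"
  assumes \<Phi>: "\<Phi> \<in> full_rank_matrices" and \<Psi>: "\<Psi> \<in> full_rank_matrices"
  shows "(mat_range \<Phi>, mat_range \<Psi>) \<in> complementary_pairs R \<longleftrightarrow> det (transpose \<Psi> ** \<Phi>) \<noteq> 0"
proof
  assume "(mat_range \<Phi>, mat_range \<Psi>) \<in> complementary_pairs R"
  then have 0: "mat_range \<Phi> \<inter> orthogonal_comp (mat_range \<Psi>) = {0}"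
    by (auto simp: complementary_pairs_def)
  have inj: "inj ((*v) \<Phi>)"
    using \<Phi> by (simp add: full_rank_matrices_def full_rank_injective)
  show "det (transpose \<Psi> ** \<Phi>) \<noteq> 0"
  proof
    assume "det (transpose \<Psi> ** \<Phi>) = 0"
    then obtain z where z: "z \<noteq> 0" "transpose \<Psi> *v (\<Phi> *v z) = 0"
      unfolding det_eq_0_iff_kernel by (auto simp: matrix_vector_mul_assoc)
    then have "\<Phi> *v z \<in> mat_range \<Phi> \<inter> orthogonal_comp (mat_range \<Psi>)"
      by (simp add: orthogonal_comp_mat_range) (simp add: mat_range_def)
    then have "\<Phi> *v z = \<Phi> *v 0" using 0 by simp
    then show False using inj z(1) by (metis injD)
  qed
next
  assume nz: "det (transpose \<Psi> ** \<Phi>) \<noteq> 0"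
  let ?P = "(*v) (oblique_matrix \<Phi> \<Psi>)"
  note props = oblique_matrix_properties[OF nz]
  have "x \<in> {v + w | v w. v \<in> mat_range \<Phi> \<and> w \<in> orthogonal_comp (mat_range \<Psi>)}" for x
  proof -
    obtain z where z: "?P x = \<Phi> *v z" using props(2)[of x] by (auto simp: mat_range_def)
    have "?P (x - ?P x) = 0"
      by (simp only: matrix_vector_mult_diff_distrib z props(1)) simp
    then have "x - ?P x \<in> orthogonal_comp (mat_range \<Psi>)"
      by (simp add: props(3) orthogonal_comp_mat_range)
    then show ?thesis using props(2)[of x] by force
  qed
  moreover have "mat_range \<Phi> \<inter> orthogonal_comp (mat_range \<Psi>) = {0}"
  proof -
    have "v = 0" if v: "v \<in> mat_range \<Phi>" "v \<in> orthogonal_comp (mat_range \<Psi>)" for v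
    proof -
      obtain z where z: "v = \<Phi> *v z" using v(1) by (auto simp: mat_range_def)
      have "?P v = 0" using v(2) by (simp add: props(3) orthogonal_comp_mat_range)
      then show ?thesis using props(1) z by metis
    qed
    moreover have "0 \<in> mat_range \<Phi>" by (auto simp: mat_range_def intro: range_eqI[of _ _ 0])
    ultimately show ?thesis by (auto simp: orthogonal_comp_mat_range)
  qed
  ultimately show "(mat_range \<Phi>, mat_range \<Psi>) \<in> complementary_pairs R"
    using mat_range_in_grassmannian \<Phi> \<Psi> unfolding complementary_pairs_def by blast
qed

lemma tendsto_oblique_matrix:
  fixes \<Phi> \<Psi> :: "'b \<Rightarrow> real^'r^'n"
  assumes "(\<Phi> \<longlongrightarrow> \<Phi>') F" "(\<Psi> \<longlongrightarrow> \<Psi>') F" "det (transpose \<Psi>' ** \<Phi>') \<noteq> 0"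
  shows "((\<lambda>k. oblique_matrix (\<Phi> k) (\<Psi> k)) \<longlongrightarrow> oblique_matrix \<Phi>' \<Psi>') F"
  unfolding oblique_matrix_def
  by (intro tendsto_matrix_mult tendsto_matrix_inv tendsto_transpose assms)

text \<open>In the quotient topology, taking ranges is continuous by definition: an open set of
  subspaces pulls back to a relatively open set of full-rank matrices, which eventually contains the
  \<open>\<Phi> k\<close>.\<close>

lemma limitin_grassmann:
  fixes R :: "'r::finite itself" and \<Phi> :: "'b \<Rightarrow> real^'r^'n"
  assumes \<Phi>: "\<And>k. \<Phi> k \<in> full_rank_matrices" and \<Phi>': "\<Phi>' \<in> full_rank_matrices"
    and lim: "(\<Phi> \<longlongrightarrow> \<Phi>') F"
  shows "limitin (grassmann_topology R) (\<lambda>k. mat_range (\<Phi> k)) (mat_range \<Phi>') F"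
proof -
  have "openin (grassmann_topology R) (grassmannian R :: (real^'n) set set)"
  proof -
    have "{\<Phi> \<in> full_rank_matrices. mat_range (\<Phi> :: real^'r^'n) \<in> grassmannian R} = full_rank_matrices"
      using mat_range_in_grassmannian by blast
    then show ?thesis by (simp add: openin_grassmann_topology)
  qed
  then have "grassmannian R \<subseteq> topspace (grassmann_topology R :: (real^'n) set topology)"
    by (rule openin_subset)
  moreover have "\<forall>\<^sub>F k in F. mat_range (\<Phi> k) \<in> U"
    if U: "openin (grassmann_topology R) U" "mat_range \<Phi>' \<in> U" for U
  proof -
    obtain S where S: "open S"
      "{\<Phi> \<in> full_rank_matrices. mat_range (\<Phi> :: real^'r^'n) \<in> U} = full_rank_matrices \<inter> S"
      using U(1) unfolding openin_grassmann_topology openin_open by blast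
    have "\<Phi>' \<in> S" using S(2) \<Phi>' U(2) by blast
    then have "\<forall>\<^sub>F k in F. \<Phi> k \<in> S" using lim S(1) topological_tendstoD by blast
    then show ?thesis
      by eventually_elim (use S(2) \<Phi> in blast)
  qed
  ultimately show ?thesis
    unfolding limitin_def using mat_range_in_grassmannian[OF \<Phi>'] by blast
qed

section \<open>Contractions and the regularization\<close>

definition matrix_pow :: "real^'n^'n \<Rightarrow> nat \<Rightarrow> real^'n^'n" where
  "matrix_pow A k = (((**) A) ^^ k) (mat 1)"

lemma matrix_pow_simps [simp]:
  "matrix_pow A 0 = mat 1" "matrix_pow A (Suc k) = A ** matrix_pow A k"
  by (simp_all add: matrix_pow_def)

lemma matrix_pow_add: "matrix_pow A (i + j) = matrix_pow A i ** matrix_pow A j"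
  by (induction i) (simp_all add: matrix_mul_assoc)

lemma det_matrix_pow: "det (matrix_pow A k) = det A ^ k"
  by (induction k) (simp_all add: det_mul)

text \<open>In the Leibniz expansion each permutation contributes a product of absolute value at
  most one. The bound is crude, but it is the same for all powers of a contraction.\<close>

lemma abs_det_le_fact:
  fixes A :: "real^'n^'n"
  assumes "\<And>i j. \<bar>A $ i $ j\<bar> \<le> 1"
  shows "\<bar>det A\<bar> \<le> fact CARD('n)"
proof -
  have "\<bar>det A\<bar> \<le> (\<Sum>p\<in>{p. p permutes (UNIV :: 'n set)}. 1)"
    unfolding det_def
  proof (rule order_trans[OF sum_abs], rule sum_mono)
    fix p :: "'n \<Rightarrow> 'n"
    have "\<bar>\<Prod>i\<in>UNIV. A $ i $ p i\<bar> \<le> 1"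
      unfolding abs_prod by (rule prod_le_1) (simp add: assms)
    then show "\<bar>of_int (sign p) * (\<Prod>i\<in>UNIV. A $ i $ p i)\<bar> \<le> 1"
      by (simp add: abs_mult sign_def)
  qed
  also have "\<dots> = fact CARD('n)"
    by (simp add: card_permutations)
  finally show ?thesis .
qed

lemma contraction_entry_le:
  fixes A :: "real^'n^'m"
  assumes "\<And>x. norm (A *v x) \<le> norm x"
  shows "\<bar>A $ i $ j\<bar> \<le> 1"
proof -
  have "\<bar>A $ i $ j\<bar> = \<bar>(A *v axis j 1) $ i\<bar>"
    by (simp add: matrix_vector_mult_basis column_def)
  also have "\<dots> \<le> norm (A *v axis j 1)" by (rule component_le_norm_cart)
  also have "\<dots> \<le> 1" using assms[of "axis j 1"] by simp
  finally show ?thesis .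
qed

lemma contraction_matrix_pow:
  assumes "\<And>x. norm (A *v x) \<le> norm x"
  shows "norm (matrix_pow A k *v x) \<le> norm x"
  by (induction k) (auto simp: matrix_vector_mul_assoc[symmetric] intro: order_trans[OF assms])

text \<open>The powers of a contraction have bounded entries, hence bounded determinants.\<close>

lemma contraction_abs_det_le_1:
  fixes A :: "real^'n^'n"
  assumes "\<And>x. norm (A *v x) \<le> norm x"
  shows "\<bar>det A\<bar> \<le> 1"
proof (rule ccontr)
  assume "\<not> \<bar>det A\<bar> \<le> 1"
  then obtain k where "fact CARD('n) < \<bar>det A\<bar> ^ k"
    using real_arch_pow[of "\<bar>det A\<bar>" "fact CARD('n)"] by auto
  moreover have "\<bar>det (matrix_pow A k)\<bar> \<le> fact CARD('n)"
    by (intro abs_det_le_fact contraction_entry_le contraction_matrix_pow assms)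
  ultimately show False by (simp add: det_matrix_pow power_abs)
qed

text \<open>Cramer's rule controls the inverse: if \<open>A *v y\<close> has norm at most one, each
  coordinate of \<open>y\<close> is, up to sign, a determinant with entries of absolute value at
  most one, hence at most \<open>fact CARD('n)\<close>. Summing coordinates gives the factor
  \<open>CARD('n)\<close>. The constant depends on the dimension alone and therefore serves every
  power of \<open>A\<close>.\<close>

lemma unimodular_contraction_lower_bound:
  fixes A :: "real^'n^'n"
  assumes A: "\<And>x. norm (A *v x) \<le> norm x" and det: "\<bar>det A\<bar> = 1"
  shows "norm y \<le> (real CARD('n) * fact CARD('n) + 1) * norm (A *v y)"
proof (rule ccontr)
  define C :: real where "C = real CARD('n) * fact CARD('n)"
  have C0: "0 \<le> C" by (simp add: C_def)
  have nz: "det A \<noteq> 0" using det by auto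
  have unit: "norm y \<le> C" if w: "norm (A *v y) \<le> 1" for y
  proof -
    have "\<bar>y $ i\<bar> \<le> fact CARD('n)" for i
    proof -
      let ?B = "\<chi> k l. if l = i then (A *v y) $ k else A $ k $ l"
      have "y $ i = det ?B / det A"
        using cramer[OF nz, of y "A *v y"] by (simp add: vec_eq_iff)
      then have "\<bar>y $ i\<bar> = \<bar>det ?B\<bar>" using det by simp
      also have "\<dots> \<le> fact CARD('n)"
        using order_trans[OF component_le_norm_cart w] contraction_entry_le[OF A]
        by (intro abs_det_le_fact) auto
      finally show ?thesis .
    qed
    then have "(\<Sum>i\<in>UNIV. \<bar>y $ i\<bar>) \<le> C"
      unfolding C_def using sum_mono[of UNIV "\<lambda>i. \<bar>y $ i\<bar>" "\<lambda>_. fact CARD('n)"] by simp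
    then show ?thesis using norm_le_l1_cart order_trans by blast
  qed
  assume "\<not> norm y \<le> (real CARD('n) * fact CARD('n) + 1) * norm (A *v y)"
  then have less: "(C + 1) * norm (A *v y) < norm y" unfolding C_def by (rule not_le_imp_less)
  then have y: "0 < norm y"
    using C0 by (smt (verit) mult_nonneg_nonneg norm_ge_zero)
  \<comment> \<open>The extra 1 in the constant pays off here: \<open>y\<close> rescaled to norm
    \<open>C + 1\<close> still has image of norm at most one, although \<open>unit\<close> allows
    only norm \<open>C\<close>.\<close>
  have "norm (A *v (((C + 1) / norm y) *\<^sub>R y)) \<le> 1"
    using less y C0 by (simp add: matrix_vector_mult_scaleR field_simps)
  then have "norm (((C + 1) / norm y) *\<^sub>R y) \<le> C" by (rule unit)
  then show False using y C0 by simp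
qed

text \<open>Powers of \<open>A\<close> are uniformly bounded below, so an orbit that has a convergent subsequence
  returns close to its starting point; this is impossible once it has lost norm.\<close>

lemma unimodular_contraction_isometry:
  fixes A :: "real^'n^'n"
  assumes A: "\<And>x. norm (A *v x) \<le> norm x" and det: "\<bar>det A\<bar> = 1"
  shows "norm (A *v v) = norm v"
proof (rule ccontr)
  assume "norm (A *v v) \<noteq> norm v"
  then have less: "norm (A *v v) < norm v" using A[of v] by simp
  define C :: real where "C = real CARD('n) * fact CARD('n) + 1"
  have C: "0 < C" by (simp add: C_def add_nonneg_pos)
  have lower: "norm y \<le> C * norm (matrix_pow A k *v y)" for y k
    unfolding C_def using det
    by (intro unimodular_contraction_lower_bound contraction_matrix_pow A)
       (simp add: det_matrix_pow power_abs)
  let ?v = "\<lambda>k. matrix_pow A k *v v"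
  have "\<forall>k. ?v k \<in> cball 0 (norm v)"
    using contraction_matrix_pow[OF A] by simp
  then obtain l s where s: "strict_mono (s :: nat \<Rightarrow> nat)" and l: "(?v \<circ> s) \<longlonglongrightarrow> l"
    using compact_cball[of 0 "norm v"] unfolding compact_def by meson
  have "Cauchy (?v \<circ> s)" using l convergent_Cauchy convergentI by blast
  \<comment> \<open>The lower bound costs a factor \<open>C\<close> when the common power is
    cancelled from two orbit points. With this threshold the orbit comes back to \<open>v\<close>
    closer than the norm lost in the first application of \<open>A\<close>.\<close>
  moreover have "0 < (norm v - norm (A *v v)) / C" using less C by simp
  ultimately obtain N where N: "\<And>m n. N \<le> m \<Longrightarrow> N \<le> n \<Longrightarrow>
      norm ((?v \<circ> s) m - (?v \<circ> s) n) < (norm v - norm (A *v v)) / C"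
    unfolding Cauchy_iff by meson
  have "s N < s (Suc N)" using s by (simp add: strict_mono_Suc_iff)
  \<comment> \<open>The return takes \<open>Suc m\<close> applications, hence at least one; after
    the first, the norm never again exceeds \<open>norm (A *v v)\<close>.\<close>
  then obtain m where m: "s (Suc N) = s N + Suc m" by (auto dest: less_imp_Suc_add)
  have "norm (?v (Suc m) - v) \<le> C * norm (matrix_pow A (s N) *v (?v (Suc m) - v))"
    by (rule lower)
  also have "matrix_pow A (s N) *v (?v (Suc m) - v) = ?v (s (Suc N)) - ?v (s N)"
    unfolding m matrix_pow_add matrix_vector_mult_diff_distrib
    by (simp add: matrix_vector_mul_assoc del: matrix_pow_simps)
  also have "C * norm \<dots> < norm v - norm (A *v v)"
    using N[of "Suc N" N] C by (simp add: field_simps)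
  finally have "norm (?v (Suc m) - v) < norm v - norm (A *v v)" .
  moreover have "norm (?v (Suc m)) \<le> norm (A *v v)"
  proof -
    have "?v (Suc m) = matrix_pow A m *v (A *v v)"
      using matrix_pow_add[of A m 1] by (simp add: matrix_vector_mul_assoc)
    then show ?thesis using contraction_matrix_pow[OF A] by metis
  qed
  ultimately show False using norm_triangle_ineq2[of v "?v (Suc m)"]
    by (simp add: norm_minus_commute)
qed

section \<open>Overlaps of two orthonormal frames and the regularization\<close>

lemma stiefel_product_contraction:
  assumes "\<Phi> \<in> stiefel" "\<Psi> \<in> stiefel"
  shows "norm ((transpose \<Psi> ** \<Phi>) *v x) \<le> norm x"
  using stiefel_norm_transpose_le[OF assms(2), of "\<Phi> *v x"] stiefel_norm[OF assms(1), of x]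
  by (simp add: matrix_vector_mul_assoc[symmetric] del: transpose_matrix_vector)

text \<open>The vector \<open>\<Psi> *v (transpose \<Psi> *v u)\<close> is the orthogonal projection
  of \<open>u\<close> onto the range of \<open>\<Psi>\<close>. As the overlap is an isometry, the
  projection of \<open>u = \<Phi> *v z\<close> has the same length as \<open>u\<close>; expanding
  the squared distance gives zero, so \<open>u\<close> is its own projection.\<close>

lemma stiefel_unimodular_subset:
  fixes \<Phi> \<Psi> :: "real^'r^'n"
  assumes \<Phi>: "\<Phi> \<in> stiefel" and \<Psi>: "\<Psi> \<in> stiefel" and det: "\<bar>det (transpose \<Psi> ** \<Phi>)\<bar> = 1"
  shows "mat_range \<Phi> \<subseteq> mat_range \<Psi>"
proof -
  have "\<Phi> *v z = \<Psi> *v (transpose \<Psi> *v (\<Phi> *v z))" for z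
  proof -
    let ?u = "\<Phi> *v z" and ?q = "transpose \<Psi> *v (\<Phi> *v z)"
    have "norm ?q = norm z"
      using unimodular_contraction_isometry[OF stiefel_product_contraction[OF \<Phi> \<Psi>] det, of z]
      by (simp add: matrix_vector_mul_assoc)
    then have q: "?q \<bullet> ?q = z \<bullet> z" by (simp add: norm_eq)
    have u: "?u \<bullet> ?u = z \<bullet> z" using stiefel_norm[OF \<Phi>, of z] by (simp add: norm_eq)
    have p: "(\<Psi> *v ?q) \<bullet> (\<Psi> *v ?q) = z \<bullet> z"
      using stiefel_norm[OF \<Psi>, of ?q] q by (simp only: norm_eq)
    have c: "(\<Psi> *v ?q) \<bullet> ?u = z \<bullet> z" using q by (simp only: inner_matrix_vector_mult)
    have "(?u - \<Psi> *v ?q) \<bullet> (?u - \<Psi> *v ?q)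
        = ?u \<bullet> ?u - 2 * ((\<Psi> *v ?q) \<bullet> ?u) + (\<Psi> *v ?q) \<bullet> (\<Psi> *v ?q)"
      by (simp only: inner_diff_left inner_diff_right inner_commute[of ?u "\<Psi> *v ?q"])
    also have "\<dots> = 0" by (simp only: u p c)
    finally show ?thesis by (simp only: inner_eq_zero_iff right_minus_eq)
  qed
  then show ?thesis unfolding mat_range_def by (metis (no_types, lifting) image_subsetI rangeI)
qed

lemma stiefel_unimodular_eq:
  fixes \<Phi> \<Psi> :: "real^'r^'n"
  assumes "\<Phi> \<in> stiefel" "\<Psi> \<in> stiefel" "\<bar>det (transpose \<Psi> ** \<Phi>)\<bar> = 1"
  shows "mat_range \<Phi> = mat_range \<Psi>"
proof (rule subset_antisym)
  have "transpose (transpose \<Psi> ** \<Phi>) = transpose \<Phi> ** \<Psi>"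
    by (simp add: matrix_transpose_mul)
  then have "\<bar>det (transpose \<Phi> ** \<Psi>)\<bar> = 1"
    using assms(3) det_transpose by metis
  then show "mat_range \<Psi> \<subseteq> mat_range \<Phi>"
    by (intro stiefel_unimodular_subset assms)
qed (intro stiefel_unimodular_subset assms)

text \<open>The coordinate matrix is \<open>transpose \<Phi> ** \<Phi>'\<close>, since
  \<open>\<Phi> ** transpose \<Phi>\<close> fixes the range of \<open>\<Phi>\<close>; it is
  invertible because \<open>\<Phi>'\<close> is injective.\<close>

lemma stiefel_change_of_basis:
  fixes \<Phi> \<Phi>' :: "real^'r^'n"
  assumes \<Phi>: "\<Phi> \<in> stiefel" and \<Phi>': "\<Phi>' \<in> full_rank_matrices"
    and range: "mat_range \<Phi>' = mat_range \<Phi>"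
  obtains A where "\<Phi>' = \<Phi> ** A" "det A \<noteq> 0"
proof (rule that)
  show eq: "\<Phi>' = \<Phi> ** (transpose \<Phi> ** \<Phi>')"
  proof (rule iffD2[OF matrix_eq], rule allI)
    fix z
    obtain w where w: "\<Phi>' *v z = \<Phi> *v w" using range unfolding mat_range_def by (metis rangeE rangeI)
    have "(\<Phi> ** (transpose \<Phi> ** \<Phi>')) *v z = \<Phi> *v (transpose \<Phi> *v (\<Phi>' *v z))"
      by (simp only: matrix_vector_mul_assoc)
    then show "\<Phi>' *v z = (\<Phi> ** (transpose \<Phi> ** \<Phi>')) *v z"
      by (simp only: w stiefel_left_inverse[OF \<Phi>])
  qed
  show "det (transpose \<Phi> ** \<Phi>') \<noteq> 0"
  proof
    assume "det (transpose \<Phi> ** \<Phi>') = 0"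
    then obtain z where z: "z \<noteq> 0" "(transpose \<Phi> ** \<Phi>') *v z = 0"
      using det_eq_0_iff_kernel by blast
    have "\<Phi>' *v z = \<Phi> *v ((transpose \<Phi> ** \<Phi>') *v z)"
      using eq matrix_vector_mul_assoc by metis
    then have "\<Phi>' *v z = \<Phi>' *v 0" by (simp add: z)
    moreover have "inj ((*v) \<Phi>')"
      using \<Phi>' by (simp add: full_rank_matrices_def full_rank_injective)
    ultimately show False using z(1) by (metis injD)
  qed
qed

text \<open>Resolves the \<open>THE\<close> in \<open>rho\<close>. Under changes of basis
  \<open>A\<close> and \<open>B\<close>, the numerator and the denominator both acquire the factor
  \<open>(det A)\<^sup>2 * (det B)\<^sup>2\<close>, which cancels; uniqueness follows by inserting
  the orthonormal frames themselves.\<close>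

lemma rho_stiefel:
  fixes R :: "'r::finite itself" and \<Phi> \<Psi> :: "real^'r^'n"
  assumes \<Phi>: "\<Phi> \<in> stiefel" and \<Psi>: "\<Psi> \<in> stiefel"
  shows "rho R (mat_range \<Phi>) (mat_range \<Psi>) = - ln ((det (transpose \<Psi> ** \<Phi>))\<^sup>2)"
  unfolding rho_def
proof (rule the_equality)
  show "\<forall>\<Phi>' \<in> full_rank_matrices. \<forall>\<Psi>' \<in> full_rank_matrices.
     mat_range (\<Phi>' :: real^'r^'n) = mat_range \<Phi> \<and> mat_range (\<Psi>' :: real^'r^'n) = mat_range \<Psi> \<longrightarrow>
     - ln ((det (transpose \<Psi> ** \<Phi>))\<^sup>2) = - ln ((det (transpose \<Psi>' ** \<Phi>'))\<^sup>2 /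
               (det (transpose \<Phi>' ** \<Phi>') * det (transpose \<Psi>' ** \<Psi>')))"
  proof (intro ballI impI)
    fix \<Phi>' \<Psi>' :: "real^'r^'n"
    assume full: "\<Phi>' \<in> full_rank_matrices" "\<Psi>' \<in> full_rank_matrices"
      and range: "mat_range \<Phi>' = mat_range \<Phi> \<and> mat_range \<Psi>' = mat_range \<Psi>"
    obtain A where A: "\<Phi>' = \<Phi> ** A" "det A \<noteq> 0"
      using stiefel_change_of_basis[OF \<Phi> full(1)] range by blast
    obtain B where B: "\<Psi>' = \<Psi> ** B" "det B \<noteq> 0"
      using stiefel_change_of_basis[OF \<Psi> full(2)] range by blast
    have "transpose \<Psi>' ** \<Phi>' = transpose B ** (transpose \<Psi> ** \<Phi>) ** A"
      by (simp add: A(1) B(1) matrix_transpose_mul matrix_mul_assoc)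
    moreover have "transpose \<Phi>' ** \<Phi>' = transpose A ** (transpose \<Phi> ** \<Phi>) ** A"
      by (simp add: A(1) matrix_transpose_mul matrix_mul_assoc)
    moreover have "transpose \<Psi>' ** \<Psi>' = transpose B ** (transpose \<Psi> ** \<Psi>) ** B"
      by (simp add: B(1) matrix_transpose_mul matrix_mul_assoc)
    ultimately have "(det (transpose \<Psi>' ** \<Phi>'))\<^sup>2 / (det (transpose \<Phi>' ** \<Phi>') * det (transpose \<Psi>' ** \<Psi>'))
        = (det (transpose \<Psi> ** \<Phi>))\<^sup>2"
      using \<Phi> \<Psi> A(2) B(2)
      by (simp add: stiefel_def det_mul det_transpose power2_eq_square field_simps)
    then show "- ln ((det (transpose \<Psi> ** \<Phi>))\<^sup>2) = - ln ((det (transpose \<Psi>' ** \<Phi>'))\<^sup>2 /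
               (det (transpose \<Phi>' ** \<Phi>') * det (transpose \<Psi>' ** \<Psi>')))"
      by simp
  qed
  fix z
  assume z: "\<forall>\<Phi>' \<in> full_rank_matrices. \<forall>\<Psi>' \<in> full_rank_matrices.
     mat_range (\<Phi>' :: real^'r^'n) = mat_range \<Phi> \<and> mat_range (\<Psi>' :: real^'r^'n) = mat_range \<Psi> \<longrightarrow>
     z = - ln ((det (transpose \<Psi>' ** \<Phi>'))\<^sup>2 /
               (det (transpose \<Phi>' ** \<Phi>') * det (transpose \<Psi>' ** \<Psi>')))"
  have "\<Phi> \<in> full_rank_matrices" "\<Psi> \<in> full_rank_matrices"
    using \<Phi> \<Psi> stiefel_full_rank by auto
  with z show "z = - ln ((det (transpose \<Psi> ** \<Phi>))\<^sup>2)"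
    using \<Phi> \<Psi> by (auto simp: stiefel_def)
qed

lemma rho_same:
  fixes R :: "'r::finite itself" and V :: "(real^'n) set"
  assumes "V \<in> grassmannian R"
  shows "rho R V V = 0"
proof -
  obtain \<Phi> :: "real^'r^'n" where "\<Phi> \<in> stiefel" "mat_range \<Phi> = V"
    using grassmannian_frame[OF assms] .
  then show ?thesis
    using rho_stiefel[of \<Phi> \<Phi> R] by (simp add: stiefel_def)
qed

lemma rho_nonneg:
  fixes R :: "'r::finite itself" and V W :: "(real^'n) set"
  assumes "V \<in> grassmannian R" "W \<in> grassmannian R"
  shows "0 \<le> rho R V W"
proof -
  obtain \<Phi> :: "real^'r^'n" where \<Phi>: "\<Phi> \<in> stiefel" "mat_range \<Phi> = V"
    using grassmannian_frame[OF assms(1)] .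
  obtain \<Psi> :: "real^'r^'n" where \<Psi>: "\<Psi> \<in> stiefel" "mat_range \<Psi> = W"
    using grassmannian_frame[OF assms(2)] .
  have "\<bar>det (transpose \<Psi> ** \<Phi>)\<bar> \<le> 1"
    by (intro contraction_abs_det_le_1 stiefel_product_contraction \<Phi> \<Psi>)
  then have "(det (transpose \<Psi> ** \<Phi>))\<^sup>2 \<le> 1" by (simp add: abs_square_le_1)
  \<comment> \<open>The determinant vanishes when the pair is not complementary; that case rests on
    the default value of \<open>ln\<close> at 0.\<close>
  then have "ln ((det (transpose \<Psi> ** \<Phi>))\<^sup>2) \<le> 0"
    by (cases "det (transpose \<Psi> ** \<Phi>) = 0") (auto simp: ln_le_zero_iff)
  then show ?thesis using rho_stiefel[OF \<Phi>(1) \<Psi>(1), of R] \<Phi>(2) \<Psi>(2) by simp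
qed

lemma rho_eq_0_imp_eq:
  fixes R :: "'r::finite itself" and V W :: "(real^'n) set"
  assumes VW: "(V, W) \<in> complementary_pairs R" and 0: "rho R V W = 0"
  shows "V = W"
proof -
  have "V \<in> grassmannian R" "W \<in> grassmannian R"
    using VW by (auto simp: complementary_pairs_def)
  then obtain \<Phi> \<Psi> :: "real^'r^'n" where \<Phi>: "\<Phi> \<in> stiefel" "mat_range \<Phi> = V"
    and \<Psi>: "\<Psi> \<in> stiefel" "mat_range \<Psi> = W"
    using grassmannian_frame by metis
  \<comment> \<open>Complementarity makes the argument of the logarithm positive, so that a
    vanishing logarithm forces it to be 1.\<close>
  have nz: "det (transpose \<Psi> ** \<Phi>) \<noteq> 0"
    using VW complementary_pairs_iff_det[of \<Phi> \<Psi> R] \<Phi> \<Psi> stiefel_full_rank by blast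
  have "ln ((det (transpose \<Psi> ** \<Phi>))\<^sup>2) = 0"
    using 0 rho_stiefel[OF \<Phi>(1) \<Psi>(1), of R] \<Phi>(2) \<Psi>(2) by simp
  then have "(det (transpose \<Psi> ** \<Phi>))\<^sup>2 = 1" using nz by (simp add: ln_eq_zero_iff)
  then have "\<bar>det (transpose \<Psi> ** \<Phi>)\<bar> = 1" by (simp add: abs_square_eq_1 power2_eq_1_iff abs_if)
  then show ?thesis
    using stiefel_unimodular_eq[OF \<Phi>(1) \<Psi>(1)] \<Phi>(2) \<Psi>(2) by simp
qed

section \<open>Existence and limits of minimizers\<close>

lemma rom_solution_eq_matrix:
  fixes \<Phi> \<Psi> :: "real^'r^'n"
  assumes "det (transpose \<Psi> ** \<Phi>) \<noteq> 0"
  shows "rom_solution f u x\<^sub>0 a b (mat_range \<Phi>) (mat_range \<Psi>) =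
    ivp_solution (\<lambda>x t. oblique_matrix \<Phi> \<Psi> *v f x (u t)) (oblique_matrix \<Phi> \<Psi> *v x\<^sub>0) a b"
  unfolding rom_solution_def oblique_projection_eq_matrix[OF assms] ..

lemma rom_state_solution:
  assumes "(V, W) \<in> rom_domain R f u x\<^sub>0 a b"
  shows "rom_solution f u x\<^sub>0 a b V W (rom_state f u x\<^sub>0 a b V W)"
proof -
  have "\<exists>\<xi>. rom_solution f u x\<^sub>0 a b V W \<xi>"
    using assms unfolding rom_domain_def by auto
  then show ?thesis
    unfolding rom_state_def by (rule someI_ex)
qed

text \<open>Membership in the domain reduces to existence of a solution: uniqueness is automatic for
  a field with continuous partial derivatives.\<close>

lemma rom_domainI:
  fixes R :: "'r::finite itself" and \<Phi> \<Psi> :: "real^'r^'n"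
  assumes F: "cont_partials (Suc k) {a..b} (\<lambda>x t. f x (u t))"
    and frames: "\<Phi> \<in> stiefel" "\<Psi> \<in> stiefel" and nz: "det (transpose \<Psi> ** \<Phi>) \<noteq> 0"
    and \<xi>: "rom_solution f u x\<^sub>0 a b (mat_range \<Phi>) (mat_range \<Psi>) \<xi>"
  shows "(mat_range \<Phi>, mat_range \<Psi>) \<in> rom_domain R f u x\<^sub>0 a b"
proof -
  have "(mat_range \<Phi>, mat_range \<Psi>) \<in> complementary_pairs R"
    using complementary_pairs_iff_det[OF frames[THEN subsetD[OF stiefel_full_rank]]] nz by simp
  moreover have "\<zeta> t = \<xi> t"
    if "rom_solution f u x\<^sub>0 a b (mat_range \<Phi>) (mat_range \<Psi>) \<zeta>" "t \<in> {a..b}" for \<zeta> t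
    using F that(1)[unfolded rom_solution_eq_matrix[OF nz]] \<xi>[unfolded rom_solution_eq_matrix[OF nz]] that(2)
    by (rule ivp_solution_unique)
  ultimately show ?thesis
    using \<xi> unfolding rom_domain_def mem_Collect_eq case_prod_conv
    by (intro conjI exI[of _ \<xi>] allI impI ballI)
qed

text \<open>The compactness statement behind everything that follows. \<open>J\<close> is left
  abstract, since only its bound along the sequence and its blow-up matter. States and
  regularization converge separately, from which the cost at any weight can be assembled.\<close>

lemma rom_limit:
  fixes R :: "'r::finite itself" and f :: "real^'n \<Rightarrow> real^'d \<Rightarrow> real^'n"
    and V W :: "nat \<Rightarrow> (real^'n) set"
  assumes F: "cont_partials (Suc m) {a..b} (\<lambda>x t. f x (u t))" and ab: "a \<le> b"
    and D: "\<And>k. (V k, W k) \<in> rom_domain R f u x\<^sub>0 a b"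
    and rho_le: "\<And>k. rho R (V k) (W k) \<le> c"
    and blow_up: "blow_up_property R f u x\<^sub>0 a b J"
    and J_le: "\<And>k. J (V k) (W k) \<le> C"
  obtains s :: "nat \<Rightarrow> nat" and V' W' where "strict_mono s" "(V', W') \<in> rom_domain R f u x\<^sub>0 a b"
    "limitin (prod_topology (grassmann_topology R) (grassmann_topology R))
       (\<lambda>k. (V (s k), W (s k))) (V', W') sequentially"
    "\<forall>t\<in>{a..b}.
       (\<lambda>k. rom_state f u x\<^sub>0 a b (V (s k)) (W (s k)) t) \<longlonglongrightarrow> rom_state f u x\<^sub>0 a b V' W' t"
    "(\<lambda>k. rho R (V (s k)) (W (s k))) \<longlonglongrightarrow> rho R V' W'"
proof -
  have pairs: "(V k, W k) \<in> complementary_pairs R" for k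
    using D by (auto simp: rom_domain_def)
  then have "V k \<in> grassmannian R" "W k \<in> grassmannian R" for k
    by (auto simp: complementary_pairs_def)
  then have "\<forall>k. \<exists>\<Phi> :: real^'r^'n. \<Phi> \<in> stiefel \<and> mat_range \<Phi> = V k"
    "\<forall>k. \<exists>\<Psi> :: real^'r^'n. \<Psi> \<in> stiefel \<and> mat_range \<Psi> = W k"
    using grassmannian_frame by metis+
  then obtain \<Phi> \<Psi> :: "nat \<Rightarrow> real^'r^'n"
    where \<Phi>: "\<And>k. \<Phi> k \<in> stiefel" "\<And>k. mat_range (\<Phi> k) = V k"
      and \<Psi>: "\<And>k. \<Psi> k \<in> stiefel" "\<And>k. mat_range (\<Psi> k) = W k"
    by metis
  let ?d = "\<lambda>k. det (transpose (\<Psi> k) ** \<Phi> k)"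
  have nz: "?d k \<noteq> 0" for k
    using pairs[of k] complementary_pairs_iff_det[of "\<Phi> k" "\<Psi> k" R]
      subsetD[OF stiefel_full_rank \<Phi>(1)] subsetD[OF stiefel_full_rank \<Psi>(1)]
    by (simp add: \<Phi>(2) \<Psi>(2))
  have rho_eq: "rho R (V k) (W k) = - ln ((?d k)\<^sup>2)" for k
    using rho_stiefel[OF \<Phi>(1) \<Psi>(1), of R k k] \<Phi>(2) \<Psi>(2) by simp
  \<comment> \<open>Inverting the logarithm turns the bound on \<open>rho\<close> into a distance of
    the overlap determinants from zero that survives the limit.\<close>
  have d_ge: "exp (- c) \<le> (?d k)\<^sup>2" for k
  proof -
    have "- c \<le> ln ((?d k)\<^sup>2)" using rho_le[of k] rho_eq[of k] by simp
    then show ?thesis using nz[of k] by (simp add: ln_ge_iff)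
  qed
  have "compact (stiefel \<times> stiefel :: ((real^'r^'n) \<times> (real^'r^'n)) set)"
    by (intro compact_Times compact_stiefel)
  moreover have "\<forall>k. (\<Phi> k, \<Psi> k) \<in> stiefel \<times> stiefel" using \<Phi> \<Psi> by simp
  ultimately obtain l s\<^sub>1 where l: "l \<in> stiefel \<times> stiefel" and s\<^sub>1: "strict_mono (s\<^sub>1 :: nat \<Rightarrow> nat)"
    and lim: "((\<lambda>k. (\<Phi> k, \<Psi> k)) \<circ> s\<^sub>1) \<longlonglongrightarrow> l"
    unfolding compact_def by meson
  obtain \<Phi>' \<Psi>' where l_eq: "l = (\<Phi>', \<Psi>')" by (cases l)
  have \<Phi>': "\<Phi>' \<in> stiefel" and \<Psi>': "\<Psi>' \<in> stiefel" using l l_eq by auto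
  have lim\<Phi>: "(\<lambda>k. \<Phi> (s\<^sub>1 k)) \<longlonglongrightarrow> \<Phi>'" and lim\<Psi>: "(\<lambda>k. \<Psi> (s\<^sub>1 k)) \<longlonglongrightarrow> \<Psi>'"
    using tendsto_fst[OF lim] tendsto_snd[OF lim] l_eq by (simp_all add: o_def)
  have limd: "(\<lambda>k. (?d (s\<^sub>1 k))\<^sup>2) \<longlonglongrightarrow> (det (transpose \<Psi>' ** \<Phi>'))\<^sup>2"
    by (intro tendsto_intros tendsto_det tendsto_matrix_mult tendsto_transpose lim\<Phi> lim\<Psi>)
  have "exp (- c) \<le> (det (transpose \<Psi>' ** \<Phi>'))\<^sup>2"
    using LIMSEQ_le_const[OF limd] d_ge by blast
  then have nz': "det (transpose \<Psi>' ** \<Phi>') \<noteq> 0"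
    using exp_gt_zero[of "- c"] by (auto simp del: exp_gt_zero)
  let ?Q = "\<lambda>k. oblique_matrix (\<Phi> (s\<^sub>1 k)) (\<Psi> (s\<^sub>1 k))"
  have limQ: "?Q \<longlonglongrightarrow> oblique_matrix \<Phi>' \<Psi>'"
    by (intro tendsto_oblique_matrix lim\<Phi> lim\<Psi> nz')
  let ?V' = "mat_range \<Phi>'" and ?W' = "mat_range \<Psi>'"
  let ?\<xi> = "\<lambda>k. rom_state f u x\<^sub>0 a b (V (s\<^sub>1 k)) (W (s\<^sub>1 k))"
  have sol: "ivp_solution (\<lambda>x t. ?Q k *v f x (u t)) (?Q k *v x\<^sub>0) a b (?\<xi> k)" for k
    using rom_state_solution[OF D[of "s\<^sub>1 k"]] \<Phi>(2) \<Psi>(2) rom_solution_eq_matrix[OF nz] by metis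
  \<comment> \<open>If the domain is all of the complementary pairs, the limit pair belongs to it at
    once; the blow-up assumption speaks about the other case only.\<close>
  have D': "(?V', ?W') \<in> rom_domain R f u x\<^sub>0 a b"
  proof (cases "rom_domain R f u x\<^sub>0 a b = complementary_pairs R")
    case True
    then show ?thesis
      using complementary_pairs_iff_det[OF subsetD[OF stiefel_full_rank \<Phi>'] subsetD[OF stiefel_full_rank \<Psi>']]
        nz' by simp
  next
    case False
    let ?S = "\<lambda>k. SUP t\<in>{a..b}. norm (?\<xi> k t)"
    have "\<not> filterlim ?S at_top sequentially"
    proof
      assume "filterlim ?S at_top sequentially"
      then have "filterlim (\<lambda>k. J (V (s\<^sub>1 k)) (W (s\<^sub>1 k))) at_top sequentially"
        using blow_up False D unfolding blow_up_property_def
        by (elim impE allE[of _ "\<lambda>k. V (s\<^sub>1 k)"] allE[of _ "\<lambda>k. W (s\<^sub>1 k)"]) auto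
      then have "\<forall>\<^sub>F k in sequentially. C + 1 \<le> J (V (s\<^sub>1 k)) (W (s\<^sub>1 k))"
        by (simp add: filterlim_at_top)
      then obtain k where "C + 1 \<le> J (V (s\<^sub>1 k)) (W (s\<^sub>1 k))"
        using eventually_happens by force
      with J_le[of "s\<^sub>1 k"] show False by simp
    qed
    then obtain M where "\<not> (\<forall>\<^sub>F k in sequentially. M \<le> ?S k)"
      by (auto simp: filterlim_at_top)
    \<comment> \<open>Failure of divergence bounds the states only along a further subsequence
      \<open>s\<^sub>2\<close>. It serves to find a solution for the limit pair; once that exists,
      \<open>ivp_solution_convergence\<close> gives convergence along all of
      \<open>s\<^sub>1\<close>.\<close>
    from not_eventually_sequentiallyD[OF this]
    obtain s\<^sub>2 where s\<^sub>2: "strict_mono (s\<^sub>2 :: nat \<Rightarrow> nat)" and S_less: "\<And>k. \<not> M \<le> ?S (s\<^sub>2 k)"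
      by blast
    have bound: "norm (?\<xi> (s\<^sub>2 k) t) \<le> M" if t: "t \<in> {a..b}" for k t
    proof -
      \<comment> \<open>A supremum of reals dominates its family only if the family is bounded
        above, which is checked for each solution before \<open>cSUP_upper\<close> is used.\<close>
      obtain B where "\<And>t. t \<in> {a..b} \<Longrightarrow> norm (?\<xi> (s\<^sub>2 k) t) \<le> B"
        using ivp_solution_bounded[OF sol[of "s\<^sub>2 k"]] by blast
      then have "bdd_above ((\<lambda>t. norm (?\<xi> (s\<^sub>2 k) t)) ` {a..b})"
        by (rule bdd_aboveI2)
      from cSUP_upper[OF t this] have "norm (?\<xi> (s\<^sub>2 k) t) \<le> ?S (s\<^sub>2 k)" .
      then show ?thesis using S_less[of k] by linarith
    qed
    have limQ2: "(\<lambda>k. ?Q (s\<^sub>2 k)) \<longlonglongrightarrow> oblique_matrix \<Phi>' \<Psi>'"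
      using LIMSEQ_subseq_LIMSEQ[OF limQ s\<^sub>2] by (simp only: o_def)
    obtain \<zeta> where "ivp_solution (\<lambda>x t. oblique_matrix \<Phi>' \<Psi>' *v f x (u t))
        (oblique_matrix \<Phi>' \<Psi>' *v x\<^sub>0) a b \<zeta>"
      using ivp_solution_limit_exists[OF F ab limQ2 sol[of "s\<^sub>2 _"] bound] .
    then show ?thesis
      by (intro rom_domainI[OF F \<Phi>' \<Psi>' nz']) (simp add: rom_solution_eq_matrix[OF nz'])
  qed
  show thesis
  proof (rule that[OF s\<^sub>1 D'])
    have full: "\<Phi>' \<in> full_rank_matrices" "\<Psi>' \<in> full_rank_matrices"
      "\<And>k. \<Phi> k \<in> full_rank_matrices" "\<And>k. \<Psi> k \<in> full_rank_matrices"
      using \<Phi>' \<Psi>' \<Phi>(1) \<Psi>(1) stiefel_full_rank by auto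
    show "limitin (prod_topology (grassmann_topology R) (grassmann_topology R))
        (\<lambda>k. (V (s\<^sub>1 k), W (s\<^sub>1 k))) (?V', ?W') sequentially"
      using limitin_grassmann[OF full(3) full(1) lim\<Phi>] limitin_grassmann[OF full(4) full(2) lim\<Psi>]
      by (simp add: limitin_pairwise o_def \<Phi>(2) \<Psi>(2))
    show "\<forall>t\<in>{a..b}. (\<lambda>k. ?\<xi> k t) \<longlonglongrightarrow> rom_state f u x\<^sub>0 a b ?V' ?W' t"
    proof
      fix t assume t: "t \<in> {a..b}"
      show "(\<lambda>k. ?\<xi> k t) \<longlonglongrightarrow> rom_state f u x\<^sub>0 a b ?V' ?W' t"
        using rom_state_solution[OF D', unfolded rom_solution_eq_matrix[OF nz']]
        by (rule ivp_solution_convergence[OF F limQ sol _ t])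
    qed
    have "(\<lambda>k. - ln ((?d (s\<^sub>1 k))\<^sup>2)) \<longlonglongrightarrow> - ln ((det (transpose \<Psi>' ** \<Phi>'))\<^sup>2)"
      by (intro tendsto_minus tendsto_ln limd) (use nz' in simp)
    then show "(\<lambda>k. rho R (V (s\<^sub>1 k)) (W (s\<^sub>1 k))) \<longlonglongrightarrow> rho R ?V' ?W'"
      by (simp only: rho_eq rho_stiefel[OF \<Phi>' \<Psi>'])
  qed
qed

text \<open>The direct method without a topology on the domain: \<open>subseq\<close> combines
  compactness of sublevel sets with continuity of the cost. It is used once for pairs and once for
  the diagonal.\<close>

lemma minimizer_exists:
  fixes J :: "'a \<Rightarrow> real"
  assumes "S \<noteq> {}" and nonneg: "\<And>x. x \<in> S \<Longrightarrow> 0 \<le> J x"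
    and subseq: "\<And>X C. \<lbrakk>\<And>k :: nat. X k \<in> S; \<And>k. J (X k) \<le> C\<rbrakk> \<Longrightarrow>
      \<exists>s x. strict_mono (s :: nat \<Rightarrow> nat) \<and> x \<in> S \<and> (\<lambda>k. J (X (s k))) \<longlonglongrightarrow> J x"
  shows "\<exists>x\<in>S. \<forall>y\<in>S. J x \<le> J y"
proof -
  define m where "m = Inf (J ` S)"
  have bdd: "bdd_below (J ` S)" using nonneg by (rule bdd_belowI2)
  have "\<forall>k :: nat. \<exists>x \<in> S. J x < m + 1 / real (Suc k)"
  proof
    fix k :: nat
    have "Inf (J ` S) < m + 1 / real (Suc k)" by (simp add: m_def)
    then show "\<exists>x \<in> S. J x < m + 1 / real (Suc k)"
      using cInf_less_iff[of "J ` S"] \<open>S \<noteq> {}\<close> bdd by auto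
  qed
  then obtain X where X: "\<And>k :: nat. X k \<in> S" "\<And>k. J (X k) < m + 1 / real (Suc k)"
    by metis
  \<comment> \<open>A bound common to the whole minimizing sequence is what \<open>subseq\<close>
    asks for.\<close>
  have "J (X k) \<le> m + 1" for k
  proof -
    have "1 / real (Suc k) \<le> 1" by simp
    with X(2)[of k] show ?thesis by linarith
  qed
  with subseq[of X "m + 1"] X(1) obtain s x where s: "strict_mono (s :: nat \<Rightarrow> nat)" and x: "x \<in> S"
    and lim: "(\<lambda>k. J (X (s k))) \<longlonglongrightarrow> J x" by blast
  have "(\<lambda>k. m + 1 / real (Suc k)) \<longlonglongrightarrow> m + 0"
    by (intro tendsto_intros LIMSEQ_Suc lim_1_over_n)
  from LIMSEQ_subseq_LIMSEQ[OF this s] have "(\<lambda>k. m + 1 / real (Suc (s k))) \<longlonglongrightarrow> m"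
    by (simp add: o_def)
  with lim have "J x \<le> m"
    by (rule LIMSEQ_le) (use X(2) less_imp_le in blast)
  then have "J x \<le> J y" if "y \<in> S" for y
    using cInf_lower[of "J y" "J ` S"] bdd that by (auto simp: m_def)
  with x show ?thesis by blast
qed

theorem corollaryC1:
  fixes R :: "'r::finite itself"
    and f :: "real^'n::finite \<Rightarrow> real^'d::finite \<Rightarrow> real^'n"
    and g :: "real^'n \<Rightarrow> real^'m::finite"
    and u :: "real \<Rightarrow> real^'d"
    and x\<^sub>0 :: "real^'n"
    and L :: nat and \<tau> :: "nat \<Rightarrow> real"
    and x :: "real \<Rightarrow> real^'n"
    and y :: "nat \<Rightarrow> real^'m"
    and Ly :: "real^'m \<Rightarrow> real"
    and D P P\<^sub>0 :: "((real^'n) set \<times> (real^'n) set) set"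
    and J :: "real \<Rightarrow> (real^'n) set \<Rightarrow> (real^'n) set \<Rightarrow> real"
  assumes "CARD('r) \<le> CARD('n)"
    and "1 \<le> L" and "strict_mono_on {..<L} \<tau>"
    and "cont_partials 2 {\<tau> 0..\<tau> (L - 1)} (\<lambda>x t. f x (u t))"
    and "C_k 2 g"
    and "fom_solution f u x\<^sub>0 (\<tau> 0) (\<tau> (L - 1)) x"
    and "\<And>l. l < L \<Longrightarrow> y l = g (x (\<tau> l))"
    and "smooth Ly" and "\<And>z. 0 \<le> Ly z"
    and P_def: "P = complementary_pairs R"
    and P0_def: "P\<^sub>0 = {(V, W) \<in> P. V = W}"
    and D_def: "D = rom_domain R f u x\<^sub>0 (\<tau> 0) (\<tau> (L - 1))"
    and J_def: "J = rom_cost R f u x\<^sub>0 g L \<tau> y Ly"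
  shows "(\<forall>\<gamma>>0. blow_up_property R f u x\<^sub>0 (\<tau> 0) (\<tau> (L - 1)) (J \<gamma>) \<longrightarrow> D \<noteq> {} \<longrightarrow>
            (\<exists>Vop Wop. (Vop, Wop) \<in> D \<and> (\<forall>(V, W)\<in>D. J \<gamma> Vop Wop \<le> J \<gamma> V W))) \<and>
         ((\<forall>\<gamma>>0. blow_up_property R f u x\<^sub>0 (\<tau> 0) (\<tau> (L - 1)) (J \<gamma>)) \<longrightarrow> D \<inter> P\<^sub>0 \<noteq> {} \<longrightarrow>
            (\<forall>V\<in>(grassmannian R :: (real^'n) set set). rho R V V = 0) \<and>
            (\<forall>Vop Wop. (\<forall>\<gamma>>0. is_minimizer (J \<gamma>) D (Vop \<gamma>) (Wop \<gamma>)) \<longrightarrow>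
               (\<forall>U. openin (subtopology (prod_topology (grassmann_topology R) (grassmann_topology R)) D) U \<and>
                    D \<inter> P\<^sub>0 \<subseteq> U \<longrightarrow>
                  (\<exists>\<Gamma>>0. \<forall>\<gamma>\<ge>\<Gamma>. (Vop \<gamma>, Wop \<gamma>) \<in> U)) \<and>
               (\<exists>c. ((\<lambda>\<gamma>. J \<gamma> (Vop \<gamma>) (Wop \<gamma>)) \<longlongrightarrow> c) at_top \<and>
                    (\<exists>V\<in>grassmannian R. (V, V) \<in> D \<and> (\<forall>\<gamma>>0. J \<gamma> V V = c)) \<and>
                    (\<forall>V\<in>grassmannian R. (V, V) \<in> D \<longrightarrow> (\<forall>\<gamma>>0. c \<le> J \<gamma> V V)))))"
proof -
  let ?a = "\<tau> 0" and ?b = "\<tau> (L - 1)"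
  let ?T = "prod_topology (grassmann_topology R) (grassmann_topology R) ::
    ((real^'n) set \<times> (real^'n) set) topology"
  \<comment> \<open>The data misfit, the part of the cost that does not depend on the
    weight.\<close>
  define E where "E V W = 1 / real L *
    (\<Sum>l<L. Ly (g (rom_state f u x\<^sub>0 ?a ?b V W (\<tau> l)) - y l))" for V W
  have J_eq: "J \<gamma> V W = E V W + \<gamma> * rho R V W" for \<gamma> V W
    by (simp add: J_def rom_cost_def E_def)
  have E_nonneg: "0 \<le> E V W" for V W
    unfolding E_def using \<open>\<And>z. 0 \<le> Ly z\<close> by (simp add: sum_nonneg)
  have mono: "\<tau> i \<le> \<tau> j" if "i \<le> j" "j < L" for i j
    using strict_mono_on_imp_mono_on[OF \<open>strict_mono_on {..<L} \<tau>\<close>] that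
    by (auto intro: mono_onD)
  have times: "\<tau> l \<in> {?a..?b}" if "l < L" for l
    using mono[of 0 l] mono[of l "L - 1"] that by auto
  have ab: "?a \<le> ?b" using times[of 0] \<open>1 \<le> L\<close> by auto
  have F: "cont_partials (Suc (Suc 0)) {?a..?b} (\<lambda>x t. f x (u t))"
    using \<open>cont_partials 2 {\<tau> 0..\<tau> (L - 1)} (\<lambda>x t. f x (u t))\<close> by (simp only: numeral_2_eq_2)
  have g: "isCont g z" and Ly: "isCont Ly w" for z w
    using C_k_continuous \<open>C_k 2 g\<close> \<open>smooth Ly\<close>
    unfolding smooth_def continuous_on_eq_continuous_at[OF open_UNIV] by blast+
  have D_grass: "V \<in> grassmannian R" "W \<in> grassmannian R" "(V, W) \<in> complementary_pairs R"
    if "(V, W) \<in> D" for V W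
    using that by (auto simp: D_def rom_domain_def complementary_pairs_def)
  have rho_0: "rho R V V = 0" if "V \<in> grassmannian R" for V :: "(real^'n) set"
    by (rule rho_same[OF that])
  have D_P0: "(V, W) \<in> D \<inter> P\<^sub>0 \<longleftrightarrow> (V, V) \<in> D \<and> V = W" for V W
    using D_grass(3) by (auto simp: P0_def P_def)
  have subseq: "\<exists>s V' W'. strict_mono (s :: nat \<Rightarrow> nat) \<and> (V', W') \<in> D \<and>
      limitin ?T (\<lambda>k. (V (s k), W (s k))) (V', W') sequentially \<and>
      (\<lambda>k. E (V (s k)) (W (s k))) \<longlonglongrightarrow> E V' W' \<and>
      (\<lambda>k. rho R (V (s k)) (W (s k))) \<longlonglongrightarrow> rho R V' W'"
    if \<gamma>: "0 < \<gamma>" and blow_up: "blow_up_property R f u x\<^sub>0 ?a ?b (J \<gamma>)"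
      and VW: "\<And>k :: nat. (V k, W k) \<in> D" and J_le: "\<And>k. J \<gamma> (V k) (W k) \<le> C" for \<gamma> C V W
  proof -
    have VW': "\<And>k. (V k, W k) \<in> rom_domain R f u x\<^sub>0 ?a ?b" using VW by (simp only: D_def)
    \<comment> \<open>Because the misfit is nonnegative, a bound on the cost bounds the penalty, and
      dividing by the positive weight bounds \<open>rho\<close>.\<close>
    have rho_le: "rho R (V k) (W k) \<le> C / \<gamma>" for k
      using J_le[of k] E_nonneg[of "V k" "W k"] \<gamma> by (simp add: J_eq field_simps)
    obtain s :: "nat \<Rightarrow> nat" and V' W' where s: "strict_mono s"
        "(V', W') \<in> rom_domain R f u x\<^sub>0 ?a ?b"
      "limitin ?T (\<lambda>k. (V (s k), W (s k))) (V', W') sequentially"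
      "\<forall>t\<in>{?a..?b}. (\<lambda>k. rom_state f u x\<^sub>0 ?a ?b (V (s k)) (W (s k)) t)
         \<longlonglongrightarrow> rom_state f u x\<^sub>0 ?a ?b V' W' t"
      "(\<lambda>k. rho R (V (s k)) (W (s k))) \<longlonglongrightarrow> rho R V' W'"
      using rom_limit[where V = V and W = W and J = "J \<gamma>", OF F ab VW' rho_le blow_up J_le] .
    have "(\<lambda>k. E (V (s k)) (W (s k))) \<longlonglongrightarrow> E V' W'"
      unfolding E_def
      by (intro tendsto_intros isCont_tendsto_compose[OF Ly] isCont_tendsto_compose[OF g] s(4)[rule_format])
        (rule times, simp)
    with s show ?thesis unfolding D_def by blast
  qed
  have part1: "\<exists>Vop Wop. (Vop, Wop) \<in> D \<and> (\<forall>(V, W)\<in>D. J \<gamma> Vop Wop \<le> J \<gamma> V W)"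
    if \<gamma>: "0 < \<gamma>" and blow_up: "blow_up_property R f u x\<^sub>0 ?a ?b (J \<gamma>)" and "D \<noteq> {}" for \<gamma>
  proof -
    let ?J = "\<lambda>p. J \<gamma> (fst p) (snd p)"
    have "\<exists>p\<in>D. \<forall>q\<in>D. ?J p \<le> ?J q"
    proof (rule minimizer_exists[of D ?J])
      show "0 \<le> ?J p" if "p \<in> D" for p
      proof -
        have "(fst p, snd p) \<in> D" using that by simp
        then have "0 \<le> rho R (fst p) (snd p)" using rho_nonneg D_grass(1,2) by blast
        then show ?thesis using \<gamma> E_nonneg[of "fst p" "snd p"] by (simp add: J_eq)
      qed
      fix X :: "nat \<Rightarrow> _" and C
      assume X: "\<And>k. X k \<in> D" "\<And>k. ?J (X k) \<le> C"
      then have "\<And>k. (fst (X k), snd (X k)) \<in> D" by simp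
      from subseq[where V = "\<lambda>k. fst (X k)" and W = "\<lambda>k. snd (X k)", OF \<gamma> blow_up this X(2)]
      obtain s V' W' where s: "strict_mono (s :: nat \<Rightarrow> nat)" "(V', W') \<in> D"
        "(\<lambda>k. E (fst (X (s k))) (snd (X (s k)))) \<longlonglongrightarrow> E V' W'"
        "(\<lambda>k. rho R (fst (X (s k))) (snd (X (s k)))) \<longlonglongrightarrow> rho R V' W'"
        by (elim exE conjE) (rule that)
      have "(\<lambda>k. ?J (X (s k))) \<longlonglongrightarrow> ?J (V', W')"
        unfolding J_eq fst_conv snd_conv by (intro tendsto_intros s)
      with s show "\<exists>s p. strict_mono (s :: nat \<Rightarrow> nat) \<and> p \<in> D \<and> (\<lambda>k. ?J (X (s k))) \<longlonglongrightarrow> ?J p"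
        by blast
    qed (rule \<open>D \<noteq> {}\<close>)
    then show ?thesis by force
  qed
  have part2: "(\<forall>U. openin (subtopology ?T D) U \<and> D \<inter> P\<^sub>0 \<subseteq> U \<longrightarrow>
                  (\<exists>\<Gamma>>0. \<forall>\<gamma>\<ge>\<Gamma>. (Vop \<gamma>, Wop \<gamma>) \<in> U)) \<and>
               (\<exists>c. ((\<lambda>\<gamma>. J \<gamma> (Vop \<gamma>) (Wop \<gamma>)) \<longlongrightarrow> c) at_top \<and>
                    (\<exists>V\<in>grassmannian R. (V, V) \<in> D \<and> (\<forall>\<gamma>>0. J \<gamma> V V = c)) \<and>
                    (\<forall>V\<in>grassmannian R. (V, V) \<in> D \<longrightarrow> (\<forall>\<gamma>>0. c \<le> J \<gamma> V V)))"
    if blow_up: "\<forall>\<gamma>>0. blow_up_property R f u x\<^sub>0 ?a ?b (J \<gamma>)" and nonempty: "D \<inter> P\<^sub>0 \<noteq> {}"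
      and op: "\<forall>\<gamma>>0. is_minimizer (J \<gamma>) D (Vop \<gamma>) (Wop \<gamma>)" for Vop Wop
  proof -
    \<comment> \<open>All sequences below are treated at weight 1: on the diagonal the weight is
      irrelevant, and minimizers for weights at least 1 have their cost at weight 1 bounded
      too.\<close>
    have blow_up1: "blow_up_property R f u x\<^sub>0 ?a ?b (J 1)" using blow_up by simp
    have J_diag: "J \<gamma> V V = E V V" if "(V, V) \<in> D" for \<gamma> V
      using D_grass(1)[OF that] by (simp add: J_eq rho_0)
    obtain V\<^sub>0 where V0: "(V\<^sub>0, V\<^sub>0) \<in> D" "\<And>V. (V, V) \<in> D \<Longrightarrow> E V\<^sub>0 V\<^sub>0 \<le> E V V"
    proof -
      let ?S = "{V. (V, V) \<in> D}"
      have "\<exists>V\<in>?S. \<forall>W\<in>?S. E V V \<le> E W W"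
      proof (rule minimizer_exists[of ?S "\<lambda>V. E V V"])
        show "?S \<noteq> {}" using nonempty D_P0 by auto
        fix X :: "nat \<Rightarrow> _" and C
        assume X: "\<And>k. X k \<in> ?S" "\<And>k. E (X k) (X k) \<le> C"
        then have "\<And>k. (X k, X k) \<in> D" "\<And>k. J 1 (X k) (X k) \<le> C"
          using J_diag by auto
        from subseq[where V = X and W = X, OF zero_less_one blow_up1 this]
        obtain s V' W' where s: "strict_mono (s :: nat \<Rightarrow> nat)" "(V', W') \<in> D"
          "(\<lambda>k. E (X (s k)) (X (s k))) \<longlonglongrightarrow> E V' W'"
          "(\<lambda>k. rho R (X (s k)) (X (s k))) \<longlonglongrightarrow> rho R V' W'"
          by (elim exE conjE) (rule that)
        have "rho R (X (s k)) (X (s k)) = 0" for k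
          using X(1)[of "s k"] D_grass(1) rho_0 by blast
        \<comment> \<open>The limit of diagonal pairs is again diagonal: \<open>rho\<close> passes
          to the limit and its zeros among complementary pairs are the equal ones.\<close>
        then have "rho R V' W' = 0" using s(4) by (simp add: LIMSEQ_const_iff)
        then have "V' = W'" using rho_eq_0_imp_eq D_grass(3)[OF s(2)] by blast
        with s show "\<exists>s V. strict_mono (s :: nat \<Rightarrow> nat) \<and> V \<in> ?S \<and> (\<lambda>k. E (X (s k)) (X (s k))) \<longlonglongrightarrow> E V V"
          by blast
      qed (rule E_nonneg)
      then show thesis using that by blast
    qed
    let ?c = "E V\<^sub>0 V\<^sub>0"
    have op_D: "(Vop \<gamma>, Wop \<gamma>) \<in> D" and op_le: "J \<gamma> (Vop \<gamma>) (Wop \<gamma>) \<le> ?c" if "0 < \<gamma>" for \<gamma>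
    proof -
      have min: "is_minimizer (J \<gamma>) D (Vop \<gamma>) (Wop \<gamma>)" using op that by blast
      then show "(Vop \<gamma>, Wop \<gamma>) \<in> D" by (simp add: is_minimizer_def)
      have "J \<gamma> (Vop \<gamma>) (Wop \<gamma>) \<le> J \<gamma> V\<^sub>0 V\<^sub>0"
        using min V0(1) unfolding is_minimizer_def by fast
      then show "J \<gamma> (Vop \<gamma>) (Wop \<gamma>) \<le> ?c" by (simp only: J_diag[OF V0(1)])
    qed
    have op_rho: "0 \<le> rho R (Vop \<gamma>) (Wop \<gamma>)" if "0 < \<gamma>" for \<gamma>
      using rho_nonneg D_grass(1,2)[OF op_D[OF that]] by blast
    \<comment> \<open>A property \<open>Q\<close> of weights that recurs at arbitrarily large
      weights yields minimizers that satisfy it and accumulate on the diagonal. Both remaining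
      claims are proved by contradiction, with \<open>Q\<close> expressing their failure.\<close>
    have accumulate: "\<exists>G V'. (\<forall>k :: nat. 1 \<le> G k \<and> Q (G k)) \<and> (V', V') \<in> D \<and>
        limitin ?T (\<lambda>k. (Vop (G k), Wop (G k))) (V', V') sequentially \<and>
        (\<lambda>k. E (Vop (G k)) (Wop (G k))) \<longlonglongrightarrow> E V' V'"
      if freq: "\<forall>\<Gamma> :: real. 0 < \<Gamma> \<longrightarrow> (\<exists>\<gamma>\<ge>\<Gamma>. Q \<gamma>)" for Q
    proof -
      have "\<forall>k. \<exists>\<gamma>. real (Suc k) \<le> \<gamma> \<and> Q \<gamma>"
        using freq of_nat_0_less_iff zero_less_Suc by blast
      then obtain H where H: "\<And>k. real (Suc k) \<le> H k" "\<And>k. Q (H k)" by metis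
      have H1: "1 \<le> H k" for k using H(1)[of k] by simp
      then have H0: "0 < H k" for k by (smt (verit))
      \<comment> \<open>Since \<open>rho\<close> is nonnegative, lowering the weight from
        \<open>H k\<close> to 1 can only decrease the cost, which \<open>?c\<close> bounds.\<close>
      have J1_le: "J 1 (Vop (H k)) (Wop (H k)) \<le> ?c" for k
        using op_le[OF H0, of k] mult_right_mono[OF H1 op_rho[OF H0], of k k] by (simp add: J_eq)
      from subseq[where V = "\<lambda>k. Vop (H k)" and W = "\<lambda>k. Wop (H k)",
          OF zero_less_one blow_up1 op_D[OF H0] J1_le]
      obtain s V' W' where s: "strict_mono (s :: nat \<Rightarrow> nat)" "(V', W') \<in> D"
        "limitin ?T (\<lambda>k. (Vop (H (s k)), Wop (H (s k)))) (V', W') sequentially"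
        "(\<lambda>k. E (Vop (H (s k))) (Wop (H (s k)))) \<longlonglongrightarrow> E V' W'"
        "(\<lambda>k. rho R (Vop (H (s k))) (Wop (H (s k)))) \<longlonglongrightarrow> rho R V' W'"
        by (elim exE conjE) (rule that)
      \<comment> \<open>Weight times \<open>rho\<close> is at most the minimal cost, hence at most
        \<open>?c\<close>; as the weight is at least \<open>Suc k\<close>, this forces
        \<open>rho\<close> to tend to zero.\<close>
      have rho_le: "rho R (Vop (H k)) (Wop (H k)) \<le> ?c * (1 / real (Suc k))" for k
      proof -
        have "real (Suc k) * rho R (Vop (H k)) (Wop (H k)) \<le> H k * rho R (Vop (H k)) (Wop (H k))"
          by (intro mult_right_mono H op_rho H0)
        also have "\<dots> \<le> ?c"
          using op_le[OF H0, of k] E_nonneg[of "Vop (H k)" "Wop (H k)"] by (simp add: J_eq)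
        finally show ?thesis by (simp add: field_simps)
      qed
      have "(\<lambda>k. ?c * (1 / real (Suc k))) \<longlonglongrightarrow> 0"
        by (intro tendsto_mult_right_zero LIMSEQ_Suc lim_1_over_n)
      from LIMSEQ_subseq_LIMSEQ[OF this s(1)]
      have "(\<lambda>k. ?c * (1 / real (Suc (s k)))) \<longlonglongrightarrow> 0" by (simp only: o_def)
      then have "(\<lambda>k. rho R (Vop (H (s k))) (Wop (H (s k)))) \<longlonglongrightarrow> 0"
        by (rule tendsto_sandwich[OF _ _ tendsto_const, rotated 2])
           (simp_all only: op_rho[OF H0] rho_le eventually_True)
      then have "rho R V' W' = 0" using s(5) LIMSEQ_unique by blast
      then have "V' = W'" using rho_eq_0_imp_eq D_grass(3)[OF s(2)] by blast
      with s H1 H(2) show ?thesis by (intro exI[of _ "\<lambda>k. H (s k)"] exI[of _ V']) auto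
    qed
    have "\<exists>\<Gamma>>0. \<forall>\<gamma>\<ge>\<Gamma>. (Vop \<gamma>, Wop \<gamma>) \<in> U"
      if U: "openin (subtopology ?T D) U" "D \<inter> P\<^sub>0 \<subseteq> U" for U
    proof (rule ccontr)
      assume "\<not> ?thesis"
      then have "\<forall>\<Gamma>. 0 < \<Gamma> \<longrightarrow> (\<exists>\<gamma>\<ge>\<Gamma>. (Vop \<gamma>, Wop \<gamma>) \<notin> U)" by blast
      from accumulate[where Q = "\<lambda>\<gamma>. (Vop \<gamma>, Wop \<gamma>) \<notin> U", OF this]
      obtain G V' where G: "\<forall>k :: nat. 1 \<le> G k \<and> (Vop (G k), Wop (G k)) \<notin> U"
        and V': "(V', V') \<in> D" "limitin ?T (\<lambda>k. (Vop (G k), Wop (G k))) (V', V') sequentially"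
        by (elim exE conjE) (rule that)
      obtain U' where U': "openin ?T U'" "U = U' \<inter> D"
        using U(1)[unfolded openin_subtopology] by (elim exE conjE) (rule that)
      have "(V', V') \<in> U" using D_P0 V'(1) U(2) by blast
      then have "(V', V') \<in> U'" using U'(2) by simp
      \<comment> \<open>The minimizers lie in \<open>D\<close>, so missing the relatively open
        \<open>U\<close> means missing the open set \<open>U'\<close> behind it, which contradicts
        convergence to a point of \<open>U'\<close>.\<close>
      with U'(1) have "\<forall>\<^sub>F k in sequentially. (Vop (G k), Wop (G k)) \<in> U'"
        using V'(2) unfolding limitin_def by simp
      from eventually_happens'[OF sequentially_bot this]
      obtain k where "(Vop (G k), Wop (G k)) \<in> U'" ..
      moreover have "(Vop (G k), Wop (G k)) \<in> D"
        using op_D[of "G k"] G by (meson less_le_trans zero_less_one)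
      ultimately show False using G U'(2) by blast
    qed
    moreover have "((\<lambda>\<gamma>. J \<gamma> (Vop \<gamma>) (Wop \<gamma>)) \<longlongrightarrow> ?c) at_top"
    proof (rule order_tendstoI)
      fix c assume "?c < c"
      then show "\<forall>\<^sub>F \<gamma> in at_top. J \<gamma> (Vop \<gamma>) (Wop \<gamma>) < c"
        using op_le by (intro eventually_mono[OF eventually_gt_at_top[of 0]]) (auto intro: le_less_trans)
    next
      \<comment> \<open>The upper estimate holds for every positive weight by comparison with the
        best diagonal pair. For the lower one, drop the nonnegative penalty: the misfits stay at
        most \<open>c\<close>, so the diagonal accumulation point would have misfit below the
        diagonal minimum.\<close>
      fix c assume c: "c < ?c"
      show "\<forall>\<^sub>F \<gamma> in at_top. c < J \<gamma> (Vop \<gamma>) (Wop \<gamma>)"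
      proof (rule ccontr)
        assume "\<not> ?thesis"
        then have "\<forall>\<Gamma>. 0 < \<Gamma> \<longrightarrow> (\<exists>\<gamma>\<ge>\<Gamma>. J \<gamma> (Vop \<gamma>) (Wop \<gamma>) \<le> c)"
          unfolding eventually_at_top_linorder by (meson not_le)
        from accumulate[where Q = "\<lambda>\<gamma>. J \<gamma> (Vop \<gamma>) (Wop \<gamma>) \<le> c", OF this]
        obtain G V' where G: "\<forall>k :: nat. 1 \<le> G k \<and> J (G k) (Vop (G k)) (Wop (G k)) \<le> c"
          and V': "(V', V') \<in> D" "(\<lambda>k. E (Vop (G k)) (Wop (G k))) \<longlonglongrightarrow> E V' V'"
          by (elim exE conjE) (rule that)
        have "E (Vop (G k)) (Wop (G k)) \<le> c" for k
        proof -
          have "0 < G k" using G by (meson less_le_trans zero_less_one)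
          then have "0 \<le> G k * rho R (Vop (G k)) (Wop (G k))" using op_rho by simp
          then show ?thesis using G[rule_format, of k] by (simp add: J_eq)
        qed
        then have "E V' V' \<le> c" using V'(2) by (intro LIMSEQ_le_const2) auto
        with c V0(2)[OF V'(1)] show False by linarith
      qed
    qed
    ultimately show ?thesis
      using V0 J_diag D_grass(1) by (intro conjI exI[of _ ?c]) auto
  qed
  show ?thesis
    by (rule conjI; (rule impI allI)+)
      (erule (2) part1, rule conjI, rule ballI, erule rho_0, (rule allI impI)+, erule (2) part2)
qed

end
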